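(* Let $G$ be a graph. Then $G\in F(\chi,2)$ if and only if $G$ contains a dominating vertex $v$ and one of the following holds: (1) $G-v \cong \overline{K_4}$ (the edgeless graph on $4$ vertices); (2) $G-v$ has $5$ vertices, contains $K_2\cup K_2\cup K_1$ as a (not necessarily induced) spanning subgraph, and is a (not necessarily induced) subgraph of $K_{2,3}$; (3) $G-v$ has $6$ vertices, is a (not necessarily induced) subgraph of $K_6-3e$, and one of the following holds: (a) $G-v\cong S_3$; (b) $G-v$ contains $K_3\cup K_3$ as a spanning subgraph; (c) $G-v\cong C_5^{(3)}$; (d) $G-v\cong C_5^{(4)}$. In particular, $F(\omega,2)\setminus \{W_5\} = F(\chi,2)\setminus \{C_5^{(3)}, C_5^{(4)}\}$ (where in the last equation $C_5^{(3)}$, $C_5^{(4)}$ denote these graphs with an added dominating vertex).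
   Context: All graphs are finite and simple; a dominating vertex is one adjacent to all other vertices. $G\cup H$ is the disjoint union; $K_n$ the complete graph, $K_{2,3}$ the complete bipartite graph with parts of sizes 2 and 3. $K_6-3e$ is $K_6$ with a perfect matching (three pairwise disjoint edges) removed. $S_3$ (the 3-sun) is a triangle $abc$ together with three vertices $x,y,z$ where $x$ is adjacent exactly to $a,b$, $y$ exactly to $b,c$, $z$ exactly to $c,a$. $C_5^{(3)}$ (resp. $C_5^{(4)}$) is a $5$-cycle together with one additional vertex adjacent to exactly three (resp. four) consecutive vertices of the cycle. $W_5$ is $C_5$ with an added dominating vertex. $\Delta,\omega,\chi$ denote maximum degree, clique number, chromatic number. For $k\in\mathbb{N}_0$: $\varOmega_k$ is the class of graphs $G$ such that every induced subgraph $H$ of $G$ (including $G$) satisfies $\Delta(H)\le\omega(H)+k-1$; $\varUpsilon_k$ is the class of graphs $G$ such that every induced subgraph $H$ of $G$ (including $G$) satisfies $\Delta(H)\le\chi(H)+k-1$. $F(\omega,k)$ (resp. $F(\chi,k)$) is the set of minimal forbidden induced subgraphs of $\varOmega_k$ (resp. $\varUpsilon_k$): graphs not in the class all of whose proper induced subgraphs are in the class (up to isomorphism). *)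

theory Defs
  imports "Graph_Theory.Graph_Theory"
begin

text \<open>
  Finite simple graphs are the \<open>pair_graph\<close>s of the Graph Theory library: symmetric, loop-free,
  finite arc relations, each edge being a pair of opposite arcs. Note that \<open>pair_graph\<close> admits
  the null graph. Induced subgraphs, (spanning) subgraphs, vertex deletion, vertex degrees and
  isomorphism are the library's.
\<close>

section \<open>Graph parameters\<close>

text \<open>Meaningful for graphs with at least one vertex only (\<open>Max\<close> of the empty set is unspecified).\<close>
definition max_degree :: "'a pair_pre_digraph \<Rightarrow> nat" where
  "max_degree G = Max (out_degree (with_proj G) ` pverts G)"

definition is_clique :: "'a pair_pre_digraph \<Rightarrow> 'a set \<Rightarrow> bool" where
  "is_clique G S \<longleftrightarrow> S \<subseteq> pverts G \<and> (\<forall>u\<in>S. \<forall>v\<in>S. u \<noteq> v \<longrightarrow> (u, v) \<in> parcs G)"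

definition clique_number :: "'a pair_pre_digraph \<Rightarrow> nat" where
  "clique_number G = Max {card S | S. is_clique G S}"

definition proper_coloring :: "'a pair_pre_digraph \<Rightarrow> nat \<Rightarrow> ('a \<Rightarrow> nat) \<Rightarrow> bool" where
  "proper_coloring G k c \<longleftrightarrow>
     (\<forall>v\<in>pverts G. c v < k) \<and> (\<forall>(u, v)\<in>parcs G. c u \<noteq> c v)"

definition chromatic_number :: "'a pair_pre_digraph \<Rightarrow> nat" where
  "chromatic_number G = (LEAST k. \<exists>c. proper_coloring G k c)"

definition dominating_vertex :: "'a pair_pre_digraph \<Rightarrow> 'a \<Rightarrow> bool" where
  "dominating_vertex G v \<longleftrightarrow> v \<in> pverts G \<and> (\<forall>u\<in>pverts G - {v}. (v, u) \<in> parcs G)"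

section \<open>The graph classes and their minimal forbidden induced subgraphs\<close>

text \<open>
  The induced subgraphs ranged over are those with at least one vertex; for the null graph the
  maximum degree is undefined. The inequalities are over the integers, so that \<open>- 1\<close> does
  not truncate.
\<close>
definition Omega_class :: "nat \<Rightarrow> 'a pair_pre_digraph set" where
  "Omega_class k = {G. pair_graph G \<and>
     (\<forall>H. induced_subgraph (with_proj H) (with_proj G) \<and> pverts H \<noteq> {} \<longrightarrow>
        int (max_degree H) \<le> int (clique_number H) + int k - 1)}"

definition Upsilon_class :: "nat \<Rightarrow> 'a pair_pre_digraph set" where
  "Upsilon_class k = {G. pair_graph G \<and>
     (\<forall>H. induced_subgraph (with_proj H) (with_proj G) \<and> pverts H \<noteq> {} \<longrightarrow>
        int (max_degree H) \<le> int (chromatic_number H) + int k - 1)}"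

definition min_forbidden :: "'a pair_pre_digraph set \<Rightarrow> 'a pair_pre_digraph set" where
  "min_forbidden \<C> = {G. pair_graph G \<and> G \<notin> \<C> \<and>
     (\<forall>H. induced_subgraph (with_proj H) (with_proj G) \<and> H \<noteq> G \<longrightarrow> H \<in> \<C>)}"

text \<open>
  The sets of minimal forbidden induced subgraphs, as isomorphism-closed sets of graphs on the
  vertex type \<^typ>\<open>'a\<close>.
\<close>
definition F_omega :: "nat \<Rightarrow> 'a pair_pre_digraph set" where
  "F_omega k = min_forbidden (Omega_class k)"

definition F_chi :: "nat \<Rightarrow> 'a pair_pre_digraph set" where
  "F_chi k = min_forbidden (Upsilon_class k)"

section \<open>Containment up to isomorphism\<close>

definition is_subgraph_of :: "('a, 'b) pre_digraph \<Rightarrow> ('c, 'd) pre_digraph \<Rightarrow> bool" where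
  "is_subgraph_of G K \<longleftrightarrow> (\<exists>H. subgraph H K \<and> digraph_iso G H)"

definition contains_spanning :: "('a, 'b) pre_digraph \<Rightarrow> ('c, 'd) pre_digraph \<Rightarrow> bool" where
  "contains_spanning G K \<longleftrightarrow> (\<exists>H. spanning H G \<and> digraph_iso H K)"

section \<open>Particular graphs\<close>

definition mk_graph :: "'a set \<Rightarrow> ('a \<times> 'a) set \<Rightarrow> 'a pair_pre_digraph" where
  "mk_graph V E = \<lparr>pverts = V, parcs = E \<union> E\<inverse>\<rparr>"

definition disjoint_union ::
    "'a pair_pre_digraph \<Rightarrow> 'b pair_pre_digraph \<Rightarrow> ('a + 'b) pair_pre_digraph" where
  "disjoint_union G H = \<lparr>pverts = pverts G <+> pverts H,
     parcs = map_prod Inl Inl ` parcs G \<union> map_prod Inr Inr ` parcs H\<rparr>"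

text \<open>The new vertex is \<^term>\<open>None\<close>.\<close>
definition add_dominating :: "'a pair_pre_digraph \<Rightarrow> 'a option pair_pre_digraph" where
  "add_dominating G = \<lparr>pverts = insert None (Some ` pverts G),
     parcs = map_prod Some Some ` parcs G \<union>
       {None} \<times> Some ` pverts G \<union> Some ` pverts G \<times> {None}\<rparr>"

definition edgeless_graph :: "nat \<Rightarrow> nat pair_pre_digraph" where
  "edgeless_graph n = mk_graph {..<n} {}"

definition complete_graph :: "nat \<Rightarrow> nat pair_pre_digraph" where
  "complete_graph n = mk_graph {..<n} {(u, v). u < n \<and> v < n \<and> u \<noteq> v}"

definition complete_bipartite_graph :: "nat \<Rightarrow> nat \<Rightarrow> (nat + nat) pair_pre_digraph" where
  "complete_bipartite_graph m n =
     mk_graph ({..<m} <+> {..<n}) (Inl ` {..<m} \<times> Inr ` {..<n})"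

definition K6_minus_3e :: "nat pair_pre_digraph" where
  "K6_minus_3e = mk_graph {..<6}
     (parcs (complete_graph 6) - {(0,1), (1,0), (2,3), (3,2), (4,5), (5,4)})"

text \<open>The triangle \<open>a b c\<close> is \<open>0 1 2\<close>, and \<open>x, y, z\<close> are \<open>3, 4, 5\<close>.\<close>
definition three_sun :: "nat pair_pre_digraph" where
  "three_sun = mk_graph {..<6}
     {(0,1), (1,2), (2,0), (3,0), (3,1), (4,1), (4,2), (5,2), (5,0)}"

definition C5 :: "nat pair_pre_digraph" where
  "C5 = mk_graph {..<5} {(0,1), (1,2), (2,3), (3,4), (4,0)}"

text \<open>The additional vertex is \<open>5\<close>.\<close>
definition C5_plus :: "nat \<Rightarrow> nat pair_pre_digraph" where
  "C5_plus j = mk_graph (insert 5 (pverts C5)) (parcs C5 \<union> {5} \<times> {..<j})"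

definition W5 :: "nat option pair_pre_digraph" where
  "W5 = add_dominating C5"

lemma complete_graph_library: "K\<^bsub>n\<^esub> (with_proj (complete_graph n))"
  by (auto simp: complete_digraph_pair_def complete_graph_def mk_graph_def)

lemma pair_graph_mk_graph:
  assumes "finite V" "E \<subseteq> V \<times> V" "\<And>v. (v, v) \<notin> E"
  shows "pair_graph (mk_graph V E)"
proof -
  have "finite E" using assms finite_subset by blast
  with assms show ?thesis
    by unfold_locales
      (auto simp: mk_graph_def symmetric_def intro!: symI dest: subsetD)
qed

lemma complete_bipartite_graph_library: "K\<^bsub>m,n\<^esub> (with_proj (complete_bipartite_graph m n))"
proof -
  interpret pair_graph "complete_bipartite_graph m n"
    unfolding complete_bipartite_graph_def by (rule pair_graph_mk_graph) auto
  have "graph (with_proj (complete_bipartite_graph m n))" by unfold_locales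
  then show ?thesis
    unfolding complete_bipartite_digraph_def
    by (intro conjI exI[of _ "Inl ` {..<m}"] exI[of _ "Inr ` {..<n}"])
      (auto simp: complete_bipartite_graph_def mk_graph_def card_image Plus_def)
qed

end

theory Submission
  imports Defs
begin

text \<open>
  A graph that is minimal with \<open>\<Delta> \<ge> \<chi> + k\<close> equals the closed neighbourhood of a vertex \<open>v\<close> of maximum
  degree, so \<open>v\<close> is dominating. Counting then shows that minimality means: for \<open>S = V - {v}\<close> both
  \<open>\<chi>(S)\<close> and \<open>\<chi>(S - w)\<close>, for every \<open>w \<in> S\<close>, equal \<open>|S| - k - 1\<close>; the same holds for \<open>\<omega>\<close>.

  For \<open>\<chi>\<close> and \<open>k = 2\<close>, no class of a colouring with \<open>|S| - 3\<close> colours is a singleton, as removing its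
  vertex would save a colour. So \<open>|S| \<ge> 2 (|S| - 3)\<close>, hence \<open>|S| \<le> 6\<close>, and the class sizes are
  4, 3 + 2 or 2 + 2 + 2. In the last case either some \<open>S - w\<close> is triangle-free and not bipartite, hence a
  pentagon, or each vertex is avoided by some triangle. The triangles are then faces of an octahedron, and either
  two of them are opposite or three of them surround a fourth face and form the 3-sun.

  For \<open>\<omega>\<close>, no vertex lies in all maximum cliques, so \<open>|S| \<ge> 2 (|S| - 3)\<close> by Hajnal's inequality, and
  \<open>S\<close> turns out to be \<open>(|S| - 3)\<close>-colourable unless it is a pentagon.
\<close>

section \<open>Colourings, cliques and degrees of vertex sets\<close>

text \<open>The two equalities answer to the two kinds of proper subset. A proper subset other than
  \<open>S\<close> misses some \<open>w\<close> in \<open>S\<close>; as each added vertex raises the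
  parameter by at most one, the value at \<open>S - w\<close> decides this case. The set
  \<open>S\<close> itself could violate the bound only at a vertex dominating \<open>S\<close>, and
  deleting such a vertex would lower the value. These arguments rest on three properties shared by
  \<chi> and \<omega>, so the reduction is carried out once for both.

  The exceptional graphs are those where a pentagon separates the parameters. A pentagon has
  \<omega> = 2 and \<chi> = 3, so it is critical for \<omega> alone. With a further vertex joined to
  three or four consecutive vertices it is critical for \<chi>, but deleting that vertex destroys
  all triangles. The equation between the families says that criticality transfers in both
  directions outside these cases.

  The octahedron enters because three disjoint non-adjacent pairs on six vertices make
  \<open>S\<close> a subgraph of K_6 minus a perfect matching, which is the octahedron.\<close>

definition proper_on :: "('a \<times> 'a) set \<Rightarrow> 'a set \<Rightarrow> ('a \<Rightarrow> nat) \<Rightarrow> bool" where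
  "proper_on E S c \<longleftrightarrow> (\<forall>u\<in>S. \<forall>v\<in>S. (u, v) \<in> E \<longrightarrow> c u \<noteq> c v)"

text \<open>Counting the colours used, rather than bounding their values, avoids renaming: when a
  colour disappears the same function \<open>c\<close> still serves.\<close>

definition colorable :: "('a \<times> 'a) set \<Rightarrow> 'a set \<Rightarrow> nat \<Rightarrow> bool" where
  "colorable E S k \<longleftrightarrow> (\<exists>c. proper_on E S c \<and> card (c ` S) \<le> k)"

definition chi :: "('a \<times> 'a) set \<Rightarrow> 'a set \<Rightarrow> nat" where
  "chi E S = (LEAST k. colorable E S k)"

definition clique :: "('a \<times> 'a) set \<Rightarrow> 'a set \<Rightarrow> bool" where
  "clique E Q \<longleftrightarrow> (\<forall>u\<in>Q. \<forall>v\<in>Q. u \<noteq> v \<longrightarrow> (u, v) \<in> E)"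

definition omega :: "('a \<times> 'a) set \<Rightarrow> 'a set \<Rightarrow> nat" where
  "omega E S = Max (card ` {Q. Q \<subseteq> S \<and> clique E Q})"

definition degree :: "('a \<times> 'a) set \<Rightarrow> 'a set \<Rightarrow> 'a \<Rightarrow> nat" where
  "degree E S v = card {u \<in> S. (v, u) \<in> E}"

lemma colorable_mono: "colorable E S k \<Longrightarrow> k \<le> l \<Longrightarrow> colorable E S l"
  unfolding colorable_def using le_trans by blast

lemma colorable_subset:
  assumes "colorable E S k" "T \<subseteq> S" "finite S"
  shows "colorable E T k"
proof -
  obtain c where c: "proper_on E S c" "card (c ` S) \<le> k"
    using assms(1) unfolding colorable_def by blast
  have "card (c ` T) \<le> card (c ` S)"
    using assms by (intro card_mono) auto
  with c assms(2) show ?thesis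
    unfolding colorable_def proper_on_def by (intro exI[of _ c]) auto
qed

lemma colorable_insert:
  assumes "colorable E (S - {w}) k" "finite S" "irrefl E"
  shows "colorable E S (Suc k)"
proof -
  obtain c where c: "proper_on E (S - {w}) c" "card (c ` (S - {w})) \<le> k"
    using assms(1) unfolding colorable_def by blast
  obtain n where n: "n \<notin> c ` (S - {w})"
    using assms(2) ex_new_if_finite[OF infinite_UNIV_nat, of "c ` (S - {w})"] by auto
  have "(c(w := n)) ` S \<subseteq> insert n (c ` (S - {w}))" by auto
  then have "card ((c(w := n)) ` S) \<le> card (insert n (c ` (S - {w})))"
    using assms(2) by (intro card_mono) auto
  also have "\<dots> \<le> Suc k" using c(2) n assms(2) by simp
  finally show ?thesis
    unfolding colorable_def using c(1) n assms(3)
    by (intro exI[of _ "c(w := n)"]) (auto simp: proper_on_def irrefl_def)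
qed

lemma colorable_card:
  assumes "finite S" "irrefl E"
  shows "colorable E S (card S)"
proof -
  obtain c :: "'a \<Rightarrow> nat" where "inj_on c S"
    using finite_imp_inj_to_nat_seg[OF assms(1)] by blast
  with assms show ?thesis
    unfolding colorable_def proper_on_def
    by (intro exI[of _ c]) (auto simp: inj_on_def irrefl_def card_image_le)
qed

text \<open>The colour of \<open>v\<close> occurs nowhere on \<open>S\<close>, so removing
  \<open>v\<close> frees it. The first conclusion guards the truncated subtraction in the
  second.\<close>

lemma colorable_dominated:
  assumes "colorable E (insert v S) k" "finite S" "\<forall>u\<in>S. (v, u) \<in> E" "v \<notin> S"
  shows "k \<noteq> 0" "colorable E S (k - 1)"
proof -
  obtain c where c: "proper_on E (insert v S) c" "card (c ` insert v S) \<le> k"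
    using assms(1) unfolding colorable_def by blast
  have "c v \<notin> c ` S" using c(1) assms(3) unfolding proper_on_def by auto
  then have "Suc (card (c ` S)) \<le> k" using c(2) assms(2) by simp
  then show "k \<noteq> 0" "colorable E S (k - 1)"
    using c(1) unfolding colorable_def proper_on_def by (auto intro!: exI[of _ c])
qed

lemma chi_le_iff:
  assumes "finite S" "irrefl E"
  shows "chi E S \<le> k \<longleftrightarrow> colorable E S k"
proof
  assume "chi E S \<le> k"
  moreover have "colorable E S (chi E S)"
    unfolding chi_def using colorable_card[OF assms] by (rule LeastI)
  ultimately show "colorable E S k" using colorable_mono by blast
qed (simp add: chi_def Least_le)

lemma clique_subset: "clique E Q \<Longrightarrow> R \<subseteq> Q \<Longrightarrow> clique E R"
  unfolding clique_def by blast

lemma clique_insert: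
  "sym E \<Longrightarrow> clique E Q \<Longrightarrow> (\<forall>u\<in>Q. (v, u) \<in> E) \<Longrightarrow> clique E (insert v Q)"
  unfolding clique_def by (auto dest: symD)

text \<open>Subsets of cliques are cliques, so a clique of at least \<open>k\<close> vertices can be
  cut down to exactly \<open>k\<close>. Lower bounds on \<open>omega\<close> thus become existence
  statements, the counterpart of \<open>chi_le_iff\<close>.\<close>

lemma omega_ge_iff:
  assumes "finite S"
  shows "k \<le> omega E S \<longleftrightarrow> (\<exists>Q\<subseteq>S. clique E Q \<and> card Q = k)"
proof -
  let ?C = "card ` {Q. Q \<subseteq> S \<and> clique E Q}"
  have fin: "finite ?C"
    by (rule finite_imageI, rule finite_subset[of _ "Pow S"]) (use assms in auto)
  moreover have "0 \<in> ?C" unfolding clique_def by (auto intro!: image_eqI[of _ _ "{}"])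
  ultimately have "k \<le> omega E S \<longleftrightarrow> (\<exists>m\<in>?C. k \<le> m)"
    unfolding omega_def by (intro Max_ge_iff) auto
  also have "\<dots> \<longleftrightarrow> (\<exists>Q\<subseteq>S. clique E Q \<and> k \<le> card Q)" by auto
  also have "\<dots> \<longleftrightarrow> (\<exists>Q\<subseteq>S. clique E Q \<and> card Q = k)"
  proof
    assume "\<exists>Q\<subseteq>S. clique E Q \<and> k \<le> card Q"
    then obtain Q where Q: "Q \<subseteq> S" "clique E Q" "k \<le> card Q" by blast
    then obtain R where "R \<subseteq> Q" "card R = k" using obtain_subset_with_card_n by metis
    then show "\<exists>Q\<subseteq>S. clique E Q \<and> card Q = k"
      using Q clique_subset[OF Q(2)] by (intro exI[of _ R]) auto
  qed auto
  finally show ?thesis .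
qed

section \<open>Critical vertex sets\<close>

text \<open>With \<open>f\<close> the chromatic or the clique number, this describes what is left of
  a minimal forbidden graph once its dominating vertex is removed. The additive form avoids
  subtraction on \<open>nat\<close>.\<close>

definition critical :: "('a set \<Rightarrow> nat) \<Rightarrow> nat \<Rightarrow> 'a set \<Rightarrow> bool" where
  "critical f k S \<longleftrightarrow> f S + k + 1 = card S \<and> (\<forall>w\<in>S. f (S - {w}) + k + 1 = card S)"

text \<open>The negation of "maximum degree at most \<open>f T + k - 1\<close>", written without
  subtraction. The empty set never violates, in accord with the exclusion of the null graph from the
  classes.\<close>

definition violating :: "('a \<times> 'a) set \<Rightarrow> ('a set \<Rightarrow> nat) \<Rightarrow> nat \<Rightarrow> 'a set \<Rightarrow> bool" where
  "violating E f k T \<longleftrightarrow> (\<exists>v\<in>T. f T + k \<le> degree E T v)"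

section \<open>Parameters that behave like the clique number\<close>

locale sym_irrefl =
  fixes E :: "('a \<times> 'a) set"
  assumes sym: "sym E" and irrefl: "irrefl E"

locale clique_like = sym_irrefl E for E :: "('a \<times> 'a) set" +
  fixes f :: "'a set \<Rightarrow> nat"
  assumes mono: "finite S \<Longrightarrow> f (S - {w}) \<le> f S"
    and step: "finite S \<Longrightarrow> f S \<le> Suc (f (S - {w}))"
    and dominated: "finite S \<Longrightarrow> v \<notin> S \<Longrightarrow> \<forall>u\<in>S. (v, u) \<in> E \<Longrightarrow> f (insert v S) = Suc (f S)"
begin

lemma subset_mono:
  assumes "finite S" "T \<subseteq> S"
  shows "f T \<le> f S"
  using assms
proof (induction "card (S - T)" arbitrary: S)
  case 0
  then show ?case by simp
next
  case (Suc n)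
  then have "S - T \<noteq> {}" by (metis card.empty nat.distinct(1))
  then obtain w where w: "w \<in> S - T" by blast
  then have "n = card (S - {w} - T)"
    using Suc.hyps(2) card_Diff_singleton[OF w] by (simp add: set_diff_eq conj_ac)
  then have "f T \<le> f (S - {w})" using Suc w by (intro Suc(1)) auto
  also have "\<dots> \<le> f S" using mono Suc by blast
  finally show ?case .
qed

text \<open>\<open>step\<close>, summed over the vertices of \<open>S - T\<close>: the parameter
  grows no faster than the cardinality.\<close>

lemma subset_step:
  assumes "finite S" "T \<subseteq> S"
  shows "f S + card T \<le> f T + card S"
  using assms
proof (induction "card (S - T)" arbitrary: S)
  case 0
  then show ?case by simp
next
  case (Suc n)
  then have "S - T \<noteq> {}" by (metis card.empty nat.distinct(1))
  then obtain w where w: "w \<in> S - T" by blast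
  then have "n = card (S - {w} - T)"
    using Suc.hyps(2) card_Diff_singleton[OF w] by (simp add: set_diff_eq conj_ac)
  then have "f (S - {w}) + card T \<le> f T + card (S - {w})" using Suc w by (intro Suc(1)) auto
  moreover have "card (S - {w}) < card S" using w Suc by (intro psubset_card_mono) auto
  ultimately show ?case using step[of S w] Suc by simp
qed

section \<open>Vertices of full degree and minimal violating sets\<close>

lemma degree_less_card:
  assumes "finite S" "v \<in> S"
  shows "degree E S v < card S"
proof -
  have "{u \<in> S. (v, u) \<in> E} \<subset> S" using assms irrefl unfolding irrefl_def by blast
  then show ?thesis unfolding degree_def using assms psubset_card_mono by blast
qed

lemma degree_dominating_iff:
  assumes "finite S" "v \<in> S"
  shows "Suc (degree E S v) = card S \<longleftrightarrow> (\<forall>u\<in>S - {v}. (v, u) \<in> E)"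
proof -
  have sub: "{u \<in> S. (v, u) \<in> E} \<subseteq> S - {v}" using irrefl unfolding irrefl_def by blast
  have "Suc (degree E S v) = card S \<longleftrightarrow> card {u \<in> S. (v, u) \<in> E} = card (S - {v})"
    using card.remove[OF assms] unfolding degree_def by simp
  also have "\<dots> \<longleftrightarrow> {u \<in> S. (v, u) \<in> E} = S - {v}"
    by (rule iffI[OF card_subset_eq[OF finite_Diff[OF assms(1)] sub]]) simp_all
  also have "\<dots> \<longleftrightarrow> (\<forall>u\<in>S - {v}. (v, u) \<in> E)"
    using sub by auto
  finally show ?thesis .
qed

text \<open>The closed neighbourhood of a violating vertex keeps its degree and does not increase
  \<open>f\<close>, so it already violates, and minimality makes it all of \<open>V\<close>. With
  \<open>S = V - {v}\<close>, violation of \<open>V\<close> bounds \<open>f S\<close> from above,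
  non-violation of \<open>V - {w}\<close> bounds \<open>f (S - {w})\<close> from below, and
  monotonicity closes the sandwich.\<close>

lemma minimal_violatingD:
  assumes fin: "finite V" and bad: "violating E f k V" and min: "\<And>T. T \<subset> V \<Longrightarrow> \<not> violating E f k T"
  obtains v where "v \<in> V" "\<forall>u\<in>V - {v}. (v, u) \<in> E" "critical f k (V - {v})"
proof -
  obtain v where v: "v \<in> V" "f V + k \<le> degree E V v"
    using bad unfolding violating_def by blast
  let ?N = "insert v {u \<in> V. (v, u) \<in> E}"
  have "{u \<in> ?N. (v, u) \<in> E} = {u \<in> V. (v, u) \<in> E}"
    using irrefl unfolding irrefl_def by auto
  then have "degree E ?N v = degree E V v" unfolding degree_def by simp
  moreover have "f ?N \<le> f V" using subset_mono v fin by simp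
  ultimately have "violating E f k ?N"
    unfolding violating_def using v by (intro bexI[of _ v]) auto
  then have N: "?N = V" using min[of ?N] v(1) by auto
  then have dom: "\<forall>u\<in>V - {v}. (v, u) \<in> E" by blast
  let ?S = "V - {v}"
  have fS: "f V = Suc (f ?S)" using dominated[of ?S v] dom fin v by (simp add: insert_absorb)
  have cV: "card V = Suc (card ?S)" using v fin by (metis card_Suc_Diff1)
  have degV: "degree E V v = card ?S"
    using degree_dominating_iff[OF fin v(1)] dom cV by simp
  have S: "f ?S + k + 1 \<le> card ?S" using v(2) fS degV by simp
  have W: "card ?S \<le> f (?S - {w}) + k + 1" if w: "w \<in> ?S" for w
  proof -
    have "\<not> violating E f k (V - {w})" using min w by blast
    then have "degree E (V - {w}) v < f (V - {w}) + k"
      using w v unfolding violating_def by force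
    moreover have "Suc (degree E (V - {w}) v) = card (V - {w})"
      using degree_dominating_iff[of "V - {w}" v] fin v w dom by auto
    moreover have "Suc (card (V - {w})) = card V"
      using fin w card_Suc_Diff1 by (metis DiffD1)
    moreover have "f (V - {w}) = Suc (f (?S - {w}))"
    proof -
      have "insert v (?S - {w}) = V - {w}" using v w by auto
      then show ?thesis using dominated[of "?S - {w}" v] dom fin by simp
    qed
    ultimately show ?thesis using cV by simp
  qed
  \<comment> \<open>Some \<open>w\<close> must exist, since the lower bound for \<open>f ?S\<close>
    comes through \<open>f (?S - {w})\<close>.\<close>
  have ne: "?S \<noteq> {}" using S by (metis add_is_0 card.empty le_zero_eq one_neq_zero)
  then obtain w where w: "w \<in> ?S" by blast
  have "critical f k ?S"
    unfolding critical_def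
  proof (intro conjI ballI)
    show "f ?S + k + 1 = card ?S" using S W[OF w] mono[of ?S w] fin by simp
    fix u assume "u \<in> ?S"
    then show "f (?S - {u}) + k + 1 = card ?S"
      using S W[of u] mono[of ?S u] fin by simp
  qed
  with v dom that show thesis by blast
qed

lemma minimal_violatingI:
  assumes fin: "finite V" and v: "v \<in> V" and dom: "\<forall>u\<in>V - {v}. (v, u) \<in> E"
    and crit: "critical f k (V - {v})"
  shows "violating E f k V" "\<And>T. T \<subset> V \<Longrightarrow> \<not> violating E f k T"
proof -
  let ?S = "V - {v}"
  have fS: "f V = Suc (f ?S)" using dominated[of ?S v] dom fin v by (simp add: insert_absorb)
  have cV: "card V = Suc (card ?S)" using v fin by (metis card_Suc_Diff1)
  have degV: "degree E V v = card ?S"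
    using degree_dominating_iff[OF fin v] dom cV by simp
  have S: "f ?S + k + 1 = card ?S" and W: "\<And>w. w \<in> ?S \<Longrightarrow> f (?S - {w}) + k + 1 = card ?S"
    using crit unfolding critical_def by auto
  show "violating E f k V"
    unfolding violating_def using v fS degV S by (intro bexI[of _ v]) auto
  fix T assume T: "T \<subset> V"
  have finT: "finite T" using T fin finite_subset by blast
  show "\<not> violating E f k T"
  proof
    assume "violating E f k T"
    then obtain u where u: "u \<in> T" "f T + k \<le> degree E T u"
      unfolding violating_def by blast
    then have less: "f T + k < card T" using degree_less_card[OF finT, of u] by simp
    show False
    proof (cases "T = ?S")
      \<comment> \<open>The degree of \<open>u\<close> is forced up to \<open>card T - 1\<close>, so
        \<open>u\<close> dominates \<open>T\<close>. Deleting it would then lower \<open>f\<close>,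
        against the equality of \<open>f T\<close> and \<open>f (T - {u})\<close>.\<close>
      case True
      then have "Suc (degree E T u) = card T"
        using u S degree_less_card[OF finT, of u] by simp
      then have "\<forall>x\<in>T - {u}. (u, x) \<in> E"
        using degree_dominating_iff[OF finT u(1)] by blast
      then have "f T = Suc (f (T - {u}))"
        using dominated[of "T - {u}" u] finT u by (simp add: insert_absorb)
      moreover have "f (T - {u}) + k + 1 = card T" "f T + k + 1 = card T"
        using S W[of u] u(1) unfolding True by auto
      ultimately show False by linarith
    next
      case False
      \<comment> \<open>On \<open>V - {w}\<close> the value of \<open>f\<close> is
        \<open>card V - k - 1\<close>, a gap of exactly \<open>k\<close> to the cardinality. By
        \<open>subset_step\<close> the gap on \<open>T\<close> is no larger, against
        \<open>less\<close>.\<close>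
      then obtain w where w: "w \<in> ?S" "w \<notin> T" using T by blast
      then have TV: "T \<subseteq> V - {w}" using T by blast
      have "insert v (?S - {w}) = V - {w}" using v w by auto
      then have "f (V - {w}) = Suc (f (?S - {w}))"
        using dominated[of "?S - {w}" v] dom fin by simp
      moreover have "Suc (card (V - {w})) = card V"
        using fin w card_Suc_Diff1 by (metis DiffD1)
      ultimately show False
        using subset_step[OF _ TV] fin W[OF w(1)] less cV by simp
    qed
  qed
qed

lemma minimal_violating_iff:
  assumes "finite V"
  shows "violating E f k V \<and> (\<forall>T. T \<subset> V \<longrightarrow> \<not> violating E f k T) \<longleftrightarrow>
    (\<exists>v\<in>V. (\<forall>u\<in>V - {v}. (v, u) \<in> E) \<and> critical f k (V - {v}))"
  using minimal_violatingD[OF assms] minimal_violatingI[OF assms] by metis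

end

section \<open>Chromatic number and clique number as instances\<close>

lemma clique_like_chi:
  assumes "sym E" "irrefl E"
  shows "clique_like E (chi E)"
proof
  fix S :: "'a set" and v w assume S: "finite S"
  have iff: "chi E T \<le> k \<longleftrightarrow> colorable E T k" if "finite T" for T k
    using chi_le_iff[OF that assms(2)] .
  show "chi E (S - {w}) \<le> chi E S"
    using S colorable_subset[of E S "chi E S" "S - {w}"] by (simp add: iff flip: iff)
  show step: "chi E S \<le> Suc (chi E (S - {w}))" for w
    using colorable_insert[OF _ S assms(2), of w] S by (simp add: iff flip: iff)
  assume v: "v \<notin> S" "\<forall>u\<in>S. (v, u) \<in> E"
  have "colorable E (insert v S) (chi E (insert v S))"
    using S by (simp flip: iff)
  note dom = colorable_dominated[OF this S v(2,1)]
  have "chi E S \<le> chi E (insert v S) - 1" using iff[OF S] dom(2) by blast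
  with dom(1) have "Suc (chi E S) \<le> chi E (insert v S)" by linarith
  moreover have "chi E (insert v S) \<le> Suc (chi E S)"
    using colorable_insert[of E "insert v S" v "chi E S"] S v assms(2) by (simp add: iff flip: iff)
  ultimately show "chi E (insert v S) = Suc (chi E S)" by simp
qed (use assms in auto)

lemma clique_like_omega:
  assumes "sym E" "irrefl E"
  shows "clique_like E (omega E)"
proof
  fix S :: "'a set" and v w assume S: "finite S"
  have iff: "k \<le> omega E T \<longleftrightarrow> (\<exists>Q\<subseteq>T. clique E Q \<and> card Q = k)" if "finite T" for T k
    using omega_ge_iff[OF that] .
  obtain Q where Q: "Q \<subseteq> S" "clique E Q" "card Q = omega E S"
    using iff[OF S, of "omega E S"] by auto
  show "omega E (S - {w}) \<le> omega E S"
    using iff[of "S - {w}" "omega E (S - {w})"] iff[OF S] S by blast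
  \<comment> \<open>Stated for an arbitrary set, since it is applied to \<open>insert v S\<close> as
    well as to \<open>S\<close>.\<close>
  have "omega E S - 1 \<le> omega E (S - {w})" if fin: "finite S" for S w
  proof -
    obtain Q where Q: "Q \<subseteq> S" "clique E Q" "card Q = omega E S"
      using iff[OF fin, of "omega E S"] by auto
    have "card (Q - {w}) \<le> omega E (S - {w})"
      using iff[of "S - {w}" "card (Q - {w})"] fin Q clique_subset[of E Q "Q - {w}"] by blast
    moreover have "card Q - 1 \<le> card (Q - {w})"
      using Q fin finite_subset by (cases "w \<in> Q") (auto simp: card_Diff_singleton)
    ultimately show ?thesis using Q by simp
  qed
  note step = this
  show "omega E S \<le> Suc (omega E (S - {w}))" using step[OF S, of w] by simp
  assume v: "v \<notin> S" "\<forall>u\<in>S. (v, u) \<in> E"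
  have "clique E (insert v Q)" using v Q assms(1) by (intro clique_insert) auto
  moreover have "card (insert v Q) = Suc (omega E S)"
    using Q v S finite_subset by (subst card_insert_disjoint) auto
  ultimately have "Suc (omega E S) \<le> omega E (insert v S)"
    using iff[of "insert v S" "Suc (omega E S)"] S Q(1) by blast
  moreover have "omega E (insert v S) \<le> Suc (omega E S)"
    using step[of "insert v S" v] S v by simp
  ultimately show "omega E (insert v S) = Suc (omega E S)" by simp
qed (use assms in auto)

section \<open>Induced subgraphs as vertex sets\<close>

definition induced :: "('a \<times> 'a) set \<Rightarrow> 'a set \<Rightarrow> 'a pair_pre_digraph" where
  "induced E S = \<lparr>pverts = S, parcs = E \<inter> S \<times> S\<rparr>"

lemma induced_simps [simp]: "pverts (induced E S) = S" "parcs (induced E S) = E \<inter> S \<times> S"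
  by (simp_all add: induced_def)

lemma wf_digraph_with_proj_iff:
  "wf_digraph (with_proj G) \<longleftrightarrow> parcs G \<subseteq> pverts G \<times> pverts G"
  unfolding wf_digraph_def by auto

lemma pair_graph_iff:
  "pair_graph G \<longleftrightarrow> finite (pverts G) \<and> parcs G \<subseteq> pverts G \<times> pverts G \<and> sym (parcs G) \<and> irrefl (parcs G)"
proof
  assume "pair_graph G"
  then interpret pair_graph G .
  show "finite (pverts G) \<and> parcs G \<subseteq> pverts G \<times> pverts G \<and> sym (parcs G) \<and> irrefl (parcs G)"
    using pair_finite_verts wellformed' arcs_symmetric no_loops'
    by (auto intro!: symI irreflI; blast)
next
  assume *: "finite (pverts G) \<and> parcs G \<subseteq> pverts G \<times> pverts G \<and> sym (parcs G) \<and> irrefl (parcs G)"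
  then have "finite (parcs G)" using finite_subset by blast
  with * show "pair_graph G"
    by unfold_locales (auto simp: symmetric_def irrefl_def)
qed

lemma induced_subgraph_iff:
  assumes "pair_graph G"
  shows "induced_subgraph (with_proj H) (with_proj G) \<longleftrightarrow> (\<exists>T\<subseteq>pverts G. H = induced (parcs G) T)"
proof -
  have "parcs G \<subseteq> pverts G \<times> pverts G" using assms pair_graph_iff by blast
  then show ?thesis
    unfolding induced_subgraph_def subgraph_def wf_digraph_with_proj_iff compatible_def
    by (cases H) (auto simp: induced_def)
qed

lemma induced_parcs: "pair_graph G \<Longrightarrow> induced (parcs G) (pverts G) = G"
  unfolding pair_graph_iff by (cases G) (auto simp: induced_def)

lemma pair_graph_induced:
  assumes "pair_graph G" "T \<subseteq> pverts G"
  shows "pair_graph (induced (parcs G) T)"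
  using assms finite_subset unfolding pair_graph_iff
  by (auto intro!: symI irreflI elim: symE simp: irrefl_def)

lemma del_vert_with_proj:
  assumes "pair_graph G"
  shows "pre_digraph.del_vert (with_proj G) v = with_proj (induced (parcs G) (pverts G - {v}))"
  using assms unfolding pair_graph_iff pre_digraph.del_vert_def with_proj_def by auto

lemma max_degree_induced:
  assumes "finite S"
  shows "max_degree (induced E S) = Max (degree E S ` S)"
proof -
  have "out_degree (with_proj (induced E S)) u = degree E S u" if "u \<in> S" for u
  proof -
    have "out_arcs (with_proj (induced E S)) u = Pair u ` {v \<in> S. (u, v) \<in> E}"
      using that unfolding out_arcs_def by auto
    then show ?thesis
      unfolding out_degree_def degree_def by (simp add: card_image inj_on_def)
  qed
  then show ?thesis unfolding max_degree_def by (simp cong: image_cong)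
qed

lemma chromatic_number_induced:
  assumes "finite S"
  shows "chromatic_number (induced E S) = chi E S"
proof -
  have "(\<exists>c. proper_coloring (induced E S) k c) \<longleftrightarrow> colorable E S k" for k
  proof
    assume "\<exists>c. proper_coloring (induced E S) k c"
    then obtain c where c: "proper_coloring (induced E S) k c" ..
    then have "c ` S \<subseteq> {..<k}" unfolding proper_coloring_def by auto
    then have "card (c ` S) \<le> k" using card_mono[of "{..<k}"] by simp
    with c show "colorable E S k"
      unfolding colorable_def proper_on_def proper_coloring_def by (intro exI[of _ c]) auto
  next
    assume "colorable E S k"
    then obtain c where c: "proper_on E S c" "card (c ` S) \<le> k"
      unfolding colorable_def by blast
    \<comment> \<open>Relabels the colours in use by an initial segment of the naturals, as
      \<open>proper_coloring\<close> demands.\<close>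
    obtain h where h: "bij_betw h (c ` S) {0..<card (c ` S)}"
      using ex_bij_betw_finite_nat assms by blast
    have "proper_coloring (induced E S) k (h \<circ> c)"
      unfolding proper_coloring_def
    proof safe
      fix v assume "v \<in> pverts (induced E S)"
      then have "h (c v) \<in> {0..<card (c ` S)}" using h by (auto dest: bij_betwE)
      then show "(h \<circ> c) v < k" using c(2) by simp
    next
      fix u v assume "(u, v) \<in> parcs (induced E S)" "(h \<circ> c) u = (h \<circ> c) v"
      then show False
        using c(1) h unfolding proper_on_def bij_betw_def by (auto dest: inj_onD)
    qed
    then show "\<exists>c. proper_coloring (induced E S) k c" by blast
  qed
  then show ?thesis unfolding chromatic_number_def chi_def by simp
qed

lemma clique_number_induced: "clique_number (induced E S) = omega E S"
proof -
  have "{card Q | Q. is_clique (induced E S) Q} = card ` {Q. Q \<subseteq> S \<and> clique E Q}"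
    unfolding is_clique_def clique_def by auto
  then show ?thesis unfolding clique_number_def omega_def by simp
qed

text \<open>The class is spelled out for an arbitrary parameter \<open>p\<close>, so that
  \<open>Omega_class\<close> and \<open>Upsilon_class\<close> are both instances; \<open>f\<close>
  is the same parameter read on vertex sets of \<open>G\<close>. Induced subgraphs are identified
  with vertex sets, and membership in the class becomes the absence of violating subsets.\<close>

lemma min_forbidden_iff:
  fixes p :: "'a pair_pre_digraph \<Rightarrow> nat" and k :: nat
  defines "\<C> \<equiv> {G. pair_graph G \<and>
     (\<forall>H. induced_subgraph (with_proj H) (with_proj G) \<and> pverts H \<noteq> {} \<longrightarrow>
        int (max_degree H) \<le> int (p H) + int k - 1)}"
  assumes G: "pair_graph G" and "clique_like (parcs G) f"
    and p: "\<And>T. T \<subseteq> pverts G \<Longrightarrow> p (induced (parcs G) T) = f T"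
  shows "G \<in> min_forbidden \<C> \<longleftrightarrow>
    (\<exists>v. dominating_vertex G v \<and> critical f k (pverts G - {v}))"
proof -
  interpret clique_like "parcs G" f by fact
  let ?E = "parcs G" and ?V = "pverts G"
  have fin: "finite ?V" using G pair_graph_iff by blast
  have bad: "(T \<noteq> {} \<longrightarrow> int (max_degree (induced ?E T)) \<le> int (p (induced ?E T)) + int k - 1)
      \<longleftrightarrow> \<not> violating ?E f k T" if T: "T \<subseteq> ?V" for T
  proof -
    have finT: "finite T" using T fin finite_subset by blast
    then have "f T + k \<le> Max (degree ?E T ` T) \<longleftrightarrow> violating ?E f k T" if "T \<noteq> {}"
      using that unfolding violating_def by (subst Max_ge_iff) auto
    moreover have "\<not> violating ?E f k {}" unfolding violating_def by simp
    ultimately show ?thesis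
      using p[OF T] max_degree_induced[OF finT, of ?E] by fastforce
  qed
  have in_C: "induced ?E T \<in> \<C> \<longleftrightarrow> (\<forall>U\<subseteq>T. \<not> violating ?E f k U)" if T: "T \<subseteq> ?V" for T
  proof -
    have ind: "induced (parcs (induced ?E T)) U = induced ?E U" if "U \<subseteq> T" for U
      using that by (auto simp: induced_def)
    have "induced ?E T \<in> \<C> \<longleftrightarrow> (\<forall>U\<subseteq>T. U \<noteq> {} \<longrightarrow>
        int (max_degree (induced ?E U)) \<le> int (p (induced ?E U)) + int k - 1)"
      unfolding \<C>_def mem_Collect_eq induced_subgraph_iff[OF pair_graph_induced[OF G T]]
      using pair_graph_induced[OF G T] ind by (metis induced_simps(1))
    also have "\<dots> \<longleftrightarrow> (\<forall>U\<subseteq>T. \<not> violating ?E f k U)"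
      using bad order_trans[OF _ T] by blast
    finally show ?thesis .
  qed
  have "G \<in> min_forbidden \<C> \<longleftrightarrow> G \<notin> \<C> \<and> (\<forall>T. T \<subset> ?V \<longrightarrow> induced ?E T \<in> \<C>)"
  proof -
    have "induced ?E T \<noteq> G \<longleftrightarrow> T \<noteq> ?V" for T
      using induced_parcs[OF G] by (metis induced_simps(1))
    then show ?thesis
      unfolding min_forbidden_def mem_Collect_eq induced_subgraph_iff[OF G] psubset_eq
      using G by blast
  qed
  also have "\<dots> \<longleftrightarrow> violating ?E f k ?V \<and> (\<forall>T. T \<subset> ?V \<longrightarrow> \<not> violating ?E f k T)"
  proof -
    have "G \<notin> \<C> \<longleftrightarrow> (\<exists>U\<subseteq>?V. violating ?E f k U)"
      using in_C[of ?V] induced_parcs[OF G] by simp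
    moreover have "(\<forall>T. T \<subset> ?V \<longrightarrow> induced ?E T \<in> \<C>) \<longleftrightarrow> (\<forall>T. T \<subset> ?V \<longrightarrow> \<not> violating ?E f k T)"
      proof (intro iffI allI impI)
      fix T assume "\<forall>T. T \<subset> ?V \<longrightarrow> induced ?E T \<in> \<C>" "T \<subset> ?V"
      then show "\<not> violating ?E f k T" using in_C[of T] by auto
    next
      fix T assume *: "\<forall>T. T \<subset> ?V \<longrightarrow> \<not> violating ?E f k T" "T \<subset> ?V"
      then have "\<forall>U\<subseteq>T. \<not> violating ?E f k U" by (meson subset_psubset_trans)
      then show "induced ?E T \<in> \<C>" using in_C[of T] *(2) by auto
    qed
    ultimately show ?thesis unfolding psubset_eq by blast
  qed
  also have "\<dots> \<longleftrightarrow> (\<exists>v. dominating_vertex G v \<and> critical f k (?V - {v}))"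
    unfolding minimal_violating_iff[OF fin] dominating_vertex_def by blast
  finally show ?thesis .
qed

lemma F_chi_iff:
  assumes "pair_graph G"
  shows "G \<in> F_chi k \<longleftrightarrow>
    (\<exists>v. dominating_vertex G v \<and> critical (chi (parcs G)) k (pverts G - {v}))"
proof -
  have "chromatic_number (induced (parcs G) T) = chi (parcs G) T" if "T \<subseteq> pverts G" for T
    using chromatic_number_induced that assms finite_subset unfolding pair_graph_iff by blast
  then show ?thesis
    unfolding F_chi_def Upsilon_class_def using assms
    by (intro min_forbidden_iff) (auto simp: pair_graph_iff intro: clique_like_chi)
qed

lemma F_omega_iff:
  assumes "pair_graph G"
  shows "G \<in> F_omega k \<longleftrightarrow>
    (\<exists>v. dominating_vertex G v \<and> critical (omega (parcs G)) k (pverts G - {v}))"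
  unfolding F_omega_def Omega_class_def using assms
  by (intro min_forbidden_iff) (auto simp: pair_graph_iff clique_number_induced intro: clique_like_omega)

section \<open>Embeddings into the particular graphs\<close>

text \<open>A \<open>digraph_iso\<close> carries separate maps for vertices, arcs, heads and tails.
  Here arcs are pairs with tail \<open>fst\<close> and head \<open>snd\<close>, so the vertex map
  determines the arc map, and a bijection respecting adjacency in both directions is enough.\<close>

lemma digraph_iso_with_proj_iff:
  assumes G: "parcs G \<subseteq> pverts G \<times> pverts G" and K: "parcs K \<subseteq> pverts K \<times> pverts K"
  shows "digraph_iso (with_proj G) (with_proj K) \<longleftrightarrow>
    (\<exists>f. bij_betw f (pverts G) (pverts K) \<and>
      (\<forall>u\<in>pverts G. \<forall>v\<in>pverts G. (f u, f v) \<in> parcs K \<longleftrightarrow> (u, v) \<in> parcs G))"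
    (is "?L \<longleftrightarrow> ?R")
proof
  assume ?L
  then obtain h where h: "pre_digraph.digraph_isomorphism (with_proj G) h"
    and K': "with_proj K = app_iso h (with_proj G)"
    unfolding digraph_iso_def by blast
  let ?f = "iso_verts h"
  have tl: "iso_tail h = fst" and hd: "iso_head h = snd"
    and V: "pverts K = ?f ` pverts G" and A: "parcs K = iso_arcs h ` parcs G"
    using K' unfolding with_proj_def app_iso_def by auto
  have arc: "iso_arcs h e = (?f (fst e), ?f (snd e))" if "e \<in> parcs G" for e
    using h that tl hd unfolding pre_digraph.digraph_isomorphism_def by (auto simp: prod_eq_iff)
  have inj: "inj_on ?f (pverts G)"
    using h unfolding pre_digraph.digraph_isomorphism_def by simp
  have A': "parcs K = (\<lambda>(u, v). (?f u, ?f v)) ` parcs G"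
    unfolding A by (intro image_cong) (auto simp: arc)
  have "(?f u, ?f v) \<in> parcs K \<longleftrightarrow> (u, v) \<in> parcs G" if uv: "u \<in> pverts G" "v \<in> pverts G" for u v
  proof
    assume "(?f u, ?f v) \<in> parcs K"
    then obtain x y where xy: "(x, y) \<in> parcs G" "?f x = ?f u" "?f y = ?f v"
      unfolding A' by auto
    moreover from xy(1) G have "x \<in> pverts G" "y \<in> pverts G" by auto
    ultimately have "x = u" "y = v" using inj_onD[OF inj] uv by blast+
    with xy show "(u, v) \<in> parcs G" by simp
  next
    assume "(u, v) \<in> parcs G"
    then show "(?f u, ?f v) \<in> parcs K" unfolding A' by force
  qed
  then show ?R using inj V unfolding bij_betw_def by blast
next
  assume ?R
  then obtain f where inj: "inj_on f (pverts G)" and V: "pverts K = f ` pverts G"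
    and arcs: "\<And>u v. u \<in> pverts G \<Longrightarrow> v \<in> pverts G \<Longrightarrow> (f u, f v) \<in> parcs K \<longleftrightarrow> (u, v) \<in> parcs G"
    unfolding bij_betw_def by blast
  let ?h = "\<lparr>iso_verts = f, iso_arcs = map_prod f f, iso_head = snd, iso_tail = fst\<rparr>"
  have "inj_on (map_prod f f) (parcs G)"
    using map_prod_inj_on[OF inj inj] G inj_on_subset by blast
  then have "pre_digraph.digraph_isomorphism (with_proj G) ?h"
    unfolding pre_digraph.digraph_isomorphism_def
    using inj G by (auto simp: wf_digraph_with_proj_iff)
  moreover have "parcs K = map_prod f f ` parcs G"
  proof
    show "parcs K \<subseteq> map_prod f f ` parcs G"
    proof
      fix e assume e: "e \<in> parcs K"
      then obtain u v where "u \<in> pverts G" "v \<in> pverts G" "e = (f u, f v)"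
        using K V by blast
      with e arcs show "e \<in> map_prod f f ` parcs G" by force
    qed
  qed (use arcs G in auto)
  then have "with_proj K = app_iso ?h (with_proj G)"
    unfolding with_proj_def app_iso_def using V by simp
  ultimately show ?L unfolding digraph_iso_def by blast
qed

text \<open>The bijection is turned around to run from \<open>K\<close> to \<open>S\<close>, so that
  the vertices of a fixed graph \<open>K\<close> name those of \<open>S\<close>.\<close>

lemma digraph_iso_induced_iff:
  assumes K: "parcs K \<subseteq> pverts K \<times> pverts K"
  shows "digraph_iso (with_proj (induced E S)) (with_proj K) \<longleftrightarrow>
    (\<exists>f. bij_betw f (pverts K) S \<and>
      (\<forall>i\<in>pverts K. \<forall>j\<in>pverts K. (f i, f j) \<in> E \<longleftrightarrow> (i, j) \<in> parcs K))"
    (is "?L \<longleftrightarrow> ?R")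
proof
  assume ?L
  then obtain f where f: "bij_betw f S (pverts K)"
    and arcs: "\<And>u v. u \<in> S \<Longrightarrow> v \<in> S \<Longrightarrow> (f u, f v) \<in> parcs K \<longleftrightarrow> (u, v) \<in> E"
    by (subst (asm) digraph_iso_with_proj_iff) (use K in auto)
  have "(inv_into S f i, inv_into S f j) \<in> E \<longleftrightarrow> (i, j) \<in> parcs K"
    if "i \<in> pverts K" "j \<in> pverts K" for i j
    using arcs[of "inv_into S f i" "inv_into S f j"] f that
    by (simp add: bij_betw_inv_into_right bij_betw_imp_surj_on inv_into_into)
  with bij_betw_inv_into[OF f] show ?R by blast
next
  assume ?R
  then obtain f where f: "bij_betw f (pverts K) S"
    and arcs: "\<And>i j. i \<in> pverts K \<Longrightarrow> j \<in> pverts K \<Longrightarrow> (f i, f j) \<in> E \<longleftrightarrow> (i, j) \<in> parcs K"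
    by blast
  let ?g = "inv_into (pverts K) f"
  have "(?g u, ?g v) \<in> parcs K \<longleftrightarrow> (u, v) \<in> E" if "u \<in> S" "v \<in> S" for u v
    using arcs[of "?g u" "?g v"] f that
    by (simp add: bij_betw_inv_into_right bij_betw_imp_surj_on inv_into_into)
  with bij_betw_inv_into[OF f] show ?L
    by (subst digraph_iso_with_proj_iff) (use K in auto)
qed

lemma digraph_iso_list_iff:
  assumes "parcs K \<subseteq> pverts K \<times> pverts K" "pverts K = {..<n}"
  shows "digraph_iso (with_proj (induced E S)) (with_proj K) \<longleftrightarrow>
    (\<exists>xs. length xs = n \<and> distinct xs \<and> set xs = S \<and>
      (\<forall>i<n. \<forall>j<n. (xs ! i, xs ! j) \<in> E \<longleftrightarrow> (i, j) \<in> parcs K))"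
    (is "?L \<longleftrightarrow> ?R")
proof
  assume ?L
  then obtain f where f: "bij_betw f {..<n} S"
    and arcs: "\<forall>i<n. \<forall>j<n. (f i, f j) \<in> E \<longleftrightarrow> (i, j) \<in> parcs K"
    unfolding digraph_iso_induced_iff[OF assms(1)] assms(2) by auto
  show ?R
    using f arcs by (intro exI[of _ "map f [0..<n]"])
      (auto simp: distinct_map bij_betw_def lessThan_atLeast0)
next
  assume ?R
  then obtain xs where xs: "length xs = n" "distinct xs" "set xs = S"
    and arcs: "\<forall>i<n. \<forall>j<n. (xs ! i, xs ! j) \<in> E \<longleftrightarrow> (i, j) \<in> parcs K"
    by blast
  then have "bij_betw (\<lambda>i. xs ! i) {..<n} S" using bij_betw_nth by blast
  with arcs show ?L unfolding digraph_iso_induced_iff[OF assms(1)] assms(2) by auto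
qed

text \<open>A spanning subgraph may drop arcs of \<open>S\<close>, so adjacency has to be preserved
  in one direction only. In the converse the witness has as arc set \<open>F\<close> just the images
  of the arcs of \<open>K\<close>.\<close>

lemma contains_spanning_iff:
  assumes "parcs K \<subseteq> pverts K \<times> pverts K"
  shows "contains_spanning (with_proj (induced E S)) (with_proj K) \<longleftrightarrow>
    (\<exists>f. bij_betw f (pverts K) S \<and> (\<forall>(i, j)\<in>parcs K. (f i, f j) \<in> E))"
    (is "?L \<longleftrightarrow> ?R")
proof
  assume ?L
  then obtain H where H: "spanning H (with_proj (induced E S))" "digraph_iso H (with_proj K)"
    unfolding contains_spanning_def by blast
  define F where "F = arcs H"
  have "tail H = fst" "head H = snd" "verts H = S" and F: "F \<subseteq> E \<inter> S \<times> S"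
    using H(1) unfolding spanning_def subgraph_def compatible_def F_def by auto
  then have HF: "H = with_proj (induced F S)"
    unfolding with_proj_def induced_def F_def by (cases H) auto
  from H(2)[unfolded HF digraph_iso_induced_iff[OF assms]] obtain f where
    f: "bij_betw f (pverts K) S"
    "\<And>i j. i \<in> pverts K \<Longrightarrow> j \<in> pverts K \<Longrightarrow> (f i, f j) \<in> F \<longleftrightarrow> (i, j) \<in> parcs K"
    by auto
  have "(f i, f j) \<in> E" if "(i, j) \<in> parcs K" for i j
    using f(2)[of i j] that assms F by auto
  with f(1) show ?R by blast
next
  assume ?R
  then obtain f where f: "bij_betw f (pverts K) S" "\<And>i j. (i, j) \<in> parcs K \<Longrightarrow> (f i, f j) \<in> E"
    by blast
  define F where "F = (\<lambda>(i, j). (f i, f j)) ` parcs K"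
  have F: "F \<subseteq> E \<inter> S \<times> S"
    using f assms unfolding F_def bij_betw_def by auto
  have "(f i, f j) \<in> F \<longleftrightarrow> (i, j) \<in> parcs K" if "i \<in> pverts K" "j \<in> pverts K" for i j
  proof
    assume "(f i, f j) \<in> F"
    then obtain x y where xy: "(x, y) \<in> parcs K" "f x = f i" "f y = f j"
      unfolding F_def by auto
    moreover from this have "x = i" "y = j"
      using inj_onD[OF bij_betw_imp_inj_on[OF f(1)]] that assms by blast+
    ultimately show "(i, j) \<in> parcs K" by simp
  qed (auto simp: F_def)
  then have "digraph_iso (with_proj (induced F S)) (with_proj K)"
    using digraph_iso_induced_iff[OF assms] f(1) by blast
  moreover have "spanning (with_proj (induced F S)) (with_proj (induced E S))"
    using F unfolding spanning_def subgraph_def compatible_def wf_digraph_with_proj_iff by auto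
  ultimately show ?L unfolding contains_spanning_def by blast
qed

lemma is_subgraph_ofD:
  assumes "is_subgraph_of (with_proj (induced E S)) (with_proj K)"
  obtains f where "inj_on f S" "f ` S \<subseteq> pverts K"
    "\<And>u v. (u, v) \<in> E \<Longrightarrow> u \<in> S \<Longrightarrow> v \<in> S \<Longrightarrow> (f u, f v) \<in> parcs K"
proof -
  obtain H where H: "subgraph H (with_proj K)" "digraph_iso (with_proj (induced E S)) H"
    using assms unfolding is_subgraph_of_def by blast
  define L where "L = \<lparr>pverts = verts H, parcs = arcs H\<rparr>"
  have "tail H = fst" "head H = snd" "verts H \<subseteq> pverts K" "arcs H \<subseteq> parcs K" "wf_digraph H"
    using H(1) unfolding subgraph_def compatible_def by auto
  then have L: "H = with_proj L" "pverts L \<subseteq> pverts K" "parcs L \<subseteq> parcs K"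
    unfolding L_def with_proj_def by auto
  then have "parcs L \<subseteq> pverts L \<times> pverts L"
    using \<open>wf_digraph H\<close> wf_digraph_with_proj_iff by blast
  with H(2) obtain f where "bij_betw f S (pverts L)"
    "\<forall>u\<in>S. \<forall>v\<in>S. (f u, f v) \<in> parcs L \<longleftrightarrow> (u, v) \<in> E"
    unfolding L(1) by (subst (asm) digraph_iso_with_proj_iff) auto
  then show thesis using L(2,3) by (intro that[of f]) (auto simp: bij_betw_def)
qed

lemma is_subgraph_ofI:
  assumes K: "parcs K \<subseteq> pverts K \<times> pverts K"
    and f: "inj_on f S" "f ` S \<subseteq> pverts K"
      "\<And>u v. (u, v) \<in> E \<Longrightarrow> u \<in> S \<Longrightarrow> v \<in> S \<Longrightarrow> (f u, f v) \<in> parcs K"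
  shows "is_subgraph_of (with_proj (induced E S)) (with_proj K)"
proof -
  define L where "L = \<lparr>pverts = f ` S, parcs = (\<lambda>(u, v). (f u, f v)) ` (E \<inter> S \<times> S)\<rparr>"
  have sub: "subgraph (with_proj L) (with_proj K)"
    using K f unfolding subgraph_def compatible_def wf_digraph_with_proj_iff L_def by auto
  have "(f u, f v) \<in> parcs L \<longleftrightarrow> (u, v) \<in> E" if uv: "u \<in> S" "v \<in> S" for u v
  proof
    assume "(f u, f v) \<in> parcs L"
    then obtain x y where xy: "(x, y) \<in> E" "x \<in> S" "y \<in> S" "f x = f u" "f y = f v"
      unfolding L_def by auto
    moreover from this have "x = u" "y = v" using uv inj_onD[OF f(1)] by blast+
    ultimately show "(u, v) \<in> E" by simp
  qed (use uv in \<open>force simp: L_def\<close>)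
  moreover have "bij_betw f S (pverts L)" using f(1) unfolding L_def bij_betw_def by simp
  moreover have "parcs L \<subseteq> pverts L \<times> pverts L" unfolding L_def by auto
  ultimately have "digraph_iso (with_proj (induced E S)) (with_proj L)"
    by (subst digraph_iso_with_proj_iff) (auto intro!: exI[of _ f])
  with sub show ?thesis unfolding is_subgraph_of_def by blast
qed

section \<open>Stable sets, pentagons and graphs with named vertices\<close>

definition stable :: "('a \<times> 'a) set \<Rightarrow> 'a set \<Rightarrow> bool" where
  "stable E A \<longleftrightarrow> (\<forall>u\<in>A. \<forall>v\<in>A. (u, v) \<notin> E)"

definition pentagon :: "('a \<times> 'a) set \<Rightarrow> 'a \<Rightarrow> 'a \<Rightarrow> 'a \<Rightarrow> 'a \<Rightarrow> 'a \<Rightarrow> bool" where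
  "pentagon E a b c d e \<longleftrightarrow> distinct [a, b, c, d, e] \<and>
    (a, b) \<in> E \<and> (b, c) \<in> E \<and> (c, d) \<in> E \<and> (d, e) \<in> E \<and> (e, a) \<in> E \<and>
    (a, c) \<notin> E \<and> (b, d) \<notin> E \<and> (c, e) \<notin> E \<and> (d, a) \<notin> E \<and> (e, b) \<notin> E"

text \<open>Symmetry and irreflexivity leave one condition per unordered pair, so that unfolding
  yields 10 conditions for five vertices and 15 for six.\<close>

lemma digraph_iso_list_sym_iff:
  assumes K: "pair_graph K" "pverts K = {..<n}" and E: "sym E" "irrefl E"
  shows "digraph_iso (with_proj (induced E S)) (with_proj K) \<longleftrightarrow>
    (\<exists>xs. length xs = n \<and> distinct xs \<and> set xs = S \<and>
      (\<forall>i<n. \<forall>j<i. (xs ! i, xs ! j) \<in> E \<longleftrightarrow> (i, j) \<in> parcs K))"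
proof -
  have K': "parcs K \<subseteq> pverts K \<times> pverts K" "sym (parcs K)" "irrefl (parcs K)"
    using K unfolding pair_graph_iff by auto
  have "(\<forall>i<n. \<forall>j<n. (xs ! i, xs ! j) \<in> E \<longleftrightarrow> (i, j) \<in> parcs K) \<longleftrightarrow>
      (\<forall>i<n. \<forall>j<i. (xs ! i, xs ! j) \<in> E \<longleftrightarrow> (i, j) \<in> parcs K)" (is "?L \<longleftrightarrow> ?R") for xs
  proof
    assume ?R
    show ?L
    proof (intro allI impI)
      fix i j assume "i < n" "j < n"
      moreover have "(u, v) \<in> E \<longleftrightarrow> (v, u) \<in> E" for u v using E(1) by (auto dest: symD)
      moreover have "(i, j) \<in> parcs K \<longleftrightarrow> (j, i) \<in> parcs K" using K'(2) by (auto dest: symD)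
      ultimately show "(xs ! i, xs ! j) \<in> E \<longleftrightarrow> (i, j) \<in> parcs K"
        using \<open>?R\<close> E(2) K'(3) by (cases i j rule: linorder_cases) (auto simp: irrefl_def)
    qed
  qed auto
  then show ?thesis unfolding digraph_iso_list_iff[OF K'(1) K(2)] by simp
qed

lemma pair_graph_C5_plus: "j \<le> 5 \<Longrightarrow> pair_graph (C5_plus j)"
  unfolding C5_plus_def C5_def mk_graph_def by (auto simp: pair_graph_iff sym_def irrefl_def)

lemma pverts_C5_plus: "pverts (C5_plus j) = {..<6}"
  unfolding C5_plus_def C5_def mk_graph_def by auto

lemma pair_graph_three_sun: "pair_graph three_sun" and pverts_three_sun: "pverts three_sun = {..<6}"
  unfolding three_sun_def mk_graph_def by (auto simp: pair_graph_iff sym_def irrefl_def)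

lemma pair_graph_C5: "pair_graph C5" and pverts_C5: "pverts C5 = {..<5}"
  unfolding C5_def mk_graph_def by (auto simp: pair_graph_iff sym_def irrefl_def)

lemma pverts_edgeless: "pverts (edgeless_graph n) = {..<n}"
  unfolding edgeless_graph_def mk_graph_def by simp

lemma ex_list_Suc: "(\<exists>xs. length xs = Suc n \<and> P xs) \<longleftrightarrow> (\<exists>x ys. length ys = n \<and> P (x # ys))"
  unfolding length_Suc_conv by blast

lemma ex_list_5: "(\<exists>xs. length xs = 5 \<and> P xs) \<longleftrightarrow> (\<exists>a b c d e. P [a, b, c, d, e])"
  and ex_list_6: "(\<exists>xs. length xs = 6 \<and> P xs) \<longleftrightarrow> (\<exists>a b c d e f. P [a, b, c, d, e, f])"
  by (simp_all add: numeral_eq_Suc ex_list_Suc)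

context sym_irrefl
begin

lemma irreflE [simp]: "(x, x) \<notin> E" using irrefl unfolding irrefl_def by blast
lemma symE: "(x, y) \<in> E \<longleftrightarrow> (y, x) \<in> E" using sym by (auto dest: symD)

lemma iso_edgeless_iff:
  "digraph_iso (with_proj (induced E S)) (with_proj (edgeless_graph n)) \<longleftrightarrow>
    finite S \<and> card S = n \<and> stable E S"
proof -
  have K: "parcs (edgeless_graph n) = {}" unfolding edgeless_graph_def mk_graph_def by simp
  have "(\<forall>i<n. \<forall>j<n. (xs ! i, xs ! j) \<notin> E) \<longleftrightarrow> stable E (set xs)" if "length xs = n" for xs
    using that unfolding stable_def all_set_conv_all_nth by simp
  then have "digraph_iso (with_proj (induced E S)) (with_proj (edgeless_graph n)) \<longleftrightarrow>
      (\<exists>xs. length xs = n \<and> distinct xs \<and> set xs = S \<and> stable E S)"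
    by (subst digraph_iso_list_iff[where n = n])
      (auto simp only: pverts_edgeless K empty_iff empty_subsetI simp_thms)
  also have "\<dots> \<longleftrightarrow> finite S \<and> card S = n \<and> stable E S"
    using finite_distinct_list distinct_card by fastforce
  finally show ?thesis .
qed

lemma iso_C5_iff:
  "digraph_iso (with_proj (induced E S)) (with_proj C5) \<longleftrightarrow>
    (\<exists>a b c d e. pentagon E a b c d e \<and> S = {a, b, c, d, e})"
  unfolding digraph_iso_list_sym_iff[OF pair_graph_C5 pverts_C5 sym irrefl] ex_list_5
  by (intro iff_exI) (auto simp: pentagon_def numeral_eq_Suc All_less_Suc C5_def mk_graph_def symE)

lemma iso_C5_plus_3_iff:
  "digraph_iso (with_proj (induced E S)) (with_proj (C5_plus 3)) \<longleftrightarrow>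
    (\<exists>a b c d e w. pentagon E a b c d e \<and> w \<notin> {a, b, c, d, e} \<and> S = {a, b, c, d, e, w} \<and>
      (w, a) \<in> E \<and> (w, b) \<in> E \<and> (w, c) \<in> E \<and> (w, d) \<notin> E \<and> (w, e) \<notin> E)"
  unfolding digraph_iso_list_sym_iff[OF pair_graph_C5_plus[of 3, simplified] pverts_C5_plus sym irrefl] ex_list_6
  by (intro iff_exI)
    (auto simp: pentagon_def numeral_eq_Suc All_less_Suc C5_plus_def C5_def mk_graph_def symE)

lemma iso_C5_plus_4_iff:
  "digraph_iso (with_proj (induced E S)) (with_proj (C5_plus 4)) \<longleftrightarrow>
    (\<exists>a b c d e w. pentagon E a b c d e \<and> w \<notin> {a, b, c, d, e} \<and> S = {a, b, c, d, e, w} \<and>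
      (w, a) \<in> E \<and> (w, b) \<in> E \<and> (w, c) \<in> E \<and> (w, d) \<in> E \<and> (w, e) \<notin> E)"
  unfolding digraph_iso_list_sym_iff[OF pair_graph_C5_plus[of 4, simplified] pverts_C5_plus sym irrefl] ex_list_6
  by (intro iff_exI)
    (auto simp: pentagon_def numeral_eq_Suc All_less_Suc C5_plus_def C5_def mk_graph_def symE)

lemma iso_three_sun_iff:
  "digraph_iso (with_proj (induced E S)) (with_proj three_sun) \<longleftrightarrow>
    (\<exists>a b c x y z. distinct [a, b, c, x, y, z] \<and> S = {a, b, c, x, y, z} \<and>
      (a, b) \<in> E \<and> (b, c) \<in> E \<and> (c, a) \<in> E \<and>
      (x, a) \<in> E \<and> (x, b) \<in> E \<and> (y, b) \<in> E \<and> (y, c) \<in> E \<and> (z, c) \<in> E \<and> (z, a) \<in> E \<and>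
      (x, c) \<notin> E \<and> (y, a) \<notin> E \<and> (z, b) \<notin> E \<and> (x, y) \<notin> E \<and> (y, z) \<notin> E \<and> (z, x) \<notin> E)"
  unfolding digraph_iso_list_sym_iff[OF pair_graph_three_sun pverts_three_sun sym irrefl] ex_list_6
  by (intro iff_exI)
    (auto simp: numeral_eq_Suc All_less_Suc three_sun_def mk_graph_def symE)

text \<open>A cover by two stable sets is a 2-colouring; the sets may overlap, ties going to
  \<open>A\<close>. The refutation form suits explicit bipartitions: each one tried yields an edge
  inside a side.\<close>

lemma not_two_colorable:
  assumes "\<not> colorable E S 2" "S \<subseteq> A \<union> B" "stable E A" "stable E B"
  shows False
proof -
  have "proper_on E S (\<lambda>x. if x \<in> A then 0 else 1)"
    using assms(2-4) unfolding proper_on_def stable_def by (simp split: if_splits) blast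
  moreover have "card ((\<lambda>x. if x \<in> A then 0 else 1 :: nat) ` S) \<le> card {0, 1 :: nat}"
    by (intro card_mono) auto
  ultimately show False using assms(1) unfolding colorable_def by (auto simp: numeral_2_eq_2)
qed

lemma three_colorableI:
  assumes "S \<subseteq> A \<union> B \<union> C" "stable E A" "stable E B" "stable E C"
  shows "colorable E S 3"
proof -
  let ?c = "\<lambda>x. if x \<in> A then 0 else if x \<in> B then 1 else 2 :: nat"
  have "proper_on E S ?c"
    using assms unfolding proper_on_def stable_def by (simp split: if_splits) blast
  moreover have "card (?c ` S) \<le> card {0, 1, 2 :: nat}"
    by (intro card_mono) auto
  ultimately show ?thesis unfolding colorable_def by (auto simp: numeral_3_eq_3)
qed

lemma clique_card_le_colorable:
  assumes "clique E Q" "Q \<subseteq> S" "finite S" "colorable E S k"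
  shows "card Q \<le> k"
proof -
  obtain c where c: "proper_on E S c" "card (c ` S) \<le> k"
    using assms(4) unfolding colorable_def by blast
  then have "inj_on c Q"
    using assms(1,2) unfolding inj_on_def clique_def proper_on_def by blast
  then have "card Q = card (c ` Q)" by (simp add: card_image)
  also have "\<dots> \<le> card (c ` S)" using assms by (intro card_mono) auto
  finally show ?thesis using c by simp
qed

text \<open>With two colours, vertices at distance two along the cycle agree. So \<open>a\<close>,
  \<open>c\<close> and \<open>e\<close> share a colour, although \<open>e\<close> and
  \<open>a\<close> are adjacent.\<close>

lemma pentagon_not_colorable:
  assumes p: "pentagon E a b c d e" "{a, b, c, d, e} \<subseteq> S" and S: "finite S"
  shows "\<not> colorable E S 2"
proof
  assume "colorable E S 2"
  then obtain f where f: "proper_on E S f" "card (f ` S) \<le> 2"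
    unfolding colorable_def by blast
  have ne: "f a \<noteq> f b" "f b \<noteq> f c" "f c \<noteq> f d" "f d \<noteq> f e" "f e \<noteq> f a"
    using f(1) p unfolding pentagon_def proper_on_def by auto
  have le: "card {f x, f y, f z} \<le> 2" if "x \<in> S" "y \<in> S" "z \<in> S" for x y z
    using f(2) card_mono[of "f ` S" "{f x, f y, f z}"] that S by simp
  have "f x = f z" if "x \<in> S" "y \<in> S" "z \<in> S" "f x \<noteq> f y" "f y \<noteq> f z" for x y z
    using le[OF that(1-3)] that(4,5) by (cases "f x = f z") auto
  with ne p(2) show False by (metis insert_subset)
qed

text \<open>Without triangles the neighbourhood of \<open>v\<close> is stable. Since the graph is
  not bipartite, the non-neighbours of \<open>v\<close> therefore contain an edge
  \<open>x y\<close>, which becomes the side of the pentagon opposite \<open>v\<close>.\<close>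

lemma pentagon_of_triangle_free:
  assumes T: "finite T" "card T = 5" and col: "\<not> colorable E T 2"
    and tri: "\<And>x y z. x \<in> T \<Longrightarrow> y \<in> T \<Longrightarrow> z \<in> T \<Longrightarrow> (x, y) \<in> E \<Longrightarrow> (y, z) \<in> E \<Longrightarrow> (z, x) \<notin> E"
  obtains a b c d e where "pentagon E a b c d e" "T = {a, b, c, d, e}"
proof -
  have nc: "(\<exists>u\<in>A. \<exists>w\<in>A. (u, w) \<in> E) \<or> (\<exists>u\<in>B. \<exists>w\<in>B. (u, w) \<in> E)" if "T \<subseteq> A \<union> B" for A B
    using not_two_colorable[OF col that] unfolding stable_def by blast
  obtain v where v: "v \<in> T" using T by fastforce
  have "\<not> ((v, x) \<in> E \<and> (v, y) \<in> E \<and> (x, y) \<in> E)" if "x \<in> T" "y \<in> T" for x y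
    using tri[OF v that] by (auto simp: symE[of y v])
  then have "stable E {u \<in> T. (v, u) \<in> E}" unfolding stable_def by blast
  then have "\<not> stable E {u \<in> T. (v, u) \<notin> E}"
    using not_two_colorable[OF col, of "{u \<in> T. (v, u) \<in> E}" "{u \<in> T. (v, u) \<notin> E}"] by auto
  then obtain x y where xy: "x \<in> T" "y \<in> T" "(x, y) \<in> E" "(v, x) \<notin> E" "(v, y) \<notin> E"
    unfolding stable_def by blast
  then have ne: "v \<noteq> x" "v \<noteq> y" "x \<noteq> y" using symE by auto
  then have "card (T - {v, x, y}) = 2"
    using T v xy by (simp add: card_Diff_subset)
  then obtain p q where pq: "T - {v, x, y} = {p, q}" "p \<noteq> q"
    unfolding card_2_iff by blast
  then have Teq: "T = {v, x, y, p, q}" and "p \<notin> {v, x, y}" "q \<notin> {v, x, y}"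
    using v xy by auto
  then have dist: "distinct [v, p, x, y, q]" "distinct [v, q, x, y, p]"
    using ne pq by auto
  \<comment> \<open>The eight bipartitions that separate \<open>x\<close> from \<open>y\<close>,
    with \<open>v\<close>, \<open>p\<close>, \<open>q\<close> distributed freely; each has an edge
    inside one of its sides.\<close>
  have "(v, p) \<in> E \<or> (v, q) \<in> E \<or> (p, q) \<in> E \<or> (p, x) \<in> E \<or> (q, x) \<in> E"
    using nc[of "{x, v, p, q}" "{y}"] Teq xy by (auto simp: symE)
  moreover have "(v, p) \<in> E \<or> (v, q) \<in> E \<or> (p, q) \<in> E \<or> (p, y) \<in> E \<or> (q, y) \<in> E"
    using nc[of "{y, v, p, q}" "{x}"] Teq xy by (auto simp: symE)
  moreover have "(p, q) \<in> E \<or> (p, x) \<in> E \<or> (q, x) \<in> E"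
    using nc[of "{x, p, q}" "{y, v}"] Teq xy by (auto simp: symE)
  moreover have "(p, q) \<in> E \<or> (p, y) \<in> E \<or> (q, y) \<in> E"
    using nc[of "{y, p, q}" "{x, v}"] Teq xy by (auto simp: symE)
  moreover have "(v, p) \<in> E \<or> (p, x) \<in> E \<or> (q, y) \<in> E"
    using nc[of "{x, v, p}" "{y, q}"] Teq xy by (auto simp: symE)
  moreover have "(v, p) \<in> E \<or> (p, y) \<in> E \<or> (q, x) \<in> E"
    using nc[of "{y, v, p}" "{x, q}"] Teq xy by (auto simp: symE)
  moreover have "(v, q) \<in> E \<or> (q, x) \<in> E \<or> (p, y) \<in> E"
    using nc[of "{x, v, q}" "{y, p}"] Teq xy by (auto simp: symE)
  moreover have "(v, q) \<in> E \<or> (q, y) \<in> E \<or> (p, x) \<in> E"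
    using nc[of "{y, v, q}" "{x, p}"] Teq xy by (auto simp: symE)
  \<comment> \<open>A triple containing \<open>v\<close> together with \<open>x\<close> or
    \<open>y\<close> is no triangle, as \<open>v\<close> misses both. This leaves the five triples
    instantiated below.\<close>
  moreover have "\<not> ((r, s) \<in> E \<and> (s, t) \<in> E \<and> (r, t) \<in> E)"
    if "r \<in> T" "s \<in> T" "t \<in> T" for r s t using tri[OF that] symE by blast
  from this[of v p q] this[of p q x] this[of p q y] this[of p x y] this[of q x y]
  have "\<not> ((v, p) \<in> E \<and> (p, q) \<in> E \<and> (v, q) \<in> E)"
    "\<not> ((p, q) \<in> E \<and> (q, x) \<in> E \<and> (p, x) \<in> E)"
    "\<not> ((p, q) \<in> E \<and> (q, y) \<in> E \<and> (p, y) \<in> E)"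
    "\<not> ((p, x) \<in> E \<and> (p, y) \<in> E)" "\<not> ((q, x) \<in> E \<and> (q, y) \<in> E)"
    using xy(3) Teq by simp_all
  ultimately have "(v, p) \<in> E \<and> (p, x) \<in> E \<and> (y, q) \<in> E \<and> (q, v) \<in> E \<and> (p, y) \<notin> E \<and> (x, q) \<notin> E \<and> (p, q) \<notin> E
    \<or> (v, q) \<in> E \<and> (q, x) \<in> E \<and> (y, p) \<in> E \<and> (p, v) \<in> E \<and> (q, y) \<notin> E \<and> (x, p) \<notin> E \<and> (q, p) \<notin> E"
    unfolding symE[of y] symE[of q v] symE[of p v] symE[of q p] symE[of x p] symE[of x q] by argo
  then have "pentagon E v p x y q \<or> pentagon E v q x y p"
    using xy dist unfolding pentagon_def by (auto simp: symE)
  then show thesis using that[of v p x y q] that[of v q x y p] Teq by auto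
qed

end

section \<open>Critical sets for the chromatic number\<close>

context sym_irrefl
begin

text \<open>Monotonicity reduces the equalities to an upper bound at \<open>S\<close> and lower
  bounds at each \<open>S - {w}\<close>. A critical \<open>S\<close> is nonempty, so
  \<open>chi E S\<close> is positive and \<open>card S\<close> is at least 4; hence
  \<open>card S - 4\<close> is not truncated.\<close>

lemma critical_chi_iff:
  assumes "finite S"
  shows "critical (chi E) 2 S \<longleftrightarrow> 4 \<le> card S \<and> colorable E S (card S - 3) \<and>
    (\<forall>w\<in>S. \<not> colorable E (S - {w}) (card S - 4))"
    (is "?L \<longleftrightarrow> ?R")
proof
  have le: "chi E T \<le> k \<longleftrightarrow> colorable E T k" if "finite T" for T k
    using chi_le_iff[OF that irrefl] .
  {
    assume ?L
    then have c: "chi E S + 3 = card S" "\<And>w. w \<in> S \<Longrightarrow> chi E (S - {w}) + 3 = card S"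
      unfolding critical_def by auto
    have "chi E S \<noteq> 0"
    proof
      assume "chi E S = 0"
      then have "colorable E S 0" using le[OF assms, of 0] by simp
      then have "S = {}" using assms unfolding colorable_def by auto
      with c(1) show False by simp
    qed
    moreover have "\<not> colorable E (S - {w}) (card S - 4)" if "w \<in> S" for w
    proof -
      have "\<not> chi E (S - {w}) \<le> card S - 4" using c(1) c(2)[OF that] \<open>chi E S \<noteq> 0\<close> by linarith
      then show ?thesis using le[of "S - {w}"] assms by simp
    qed
    moreover have "colorable E S (card S - 3)" using le[OF assms, of "chi E S"] c(1)
      by (metis add_diff_cancel_right' order_refl)
    ultimately show ?R using c(1) by auto
  next
    assume R: ?R
    have S: "chi E S \<le> card S - 3" using R le[OF assms] by blast
    have W: "card S - 3 \<le> chi E (S - {w}) \<and> chi E (S - {w}) \<le> chi E S" if "w \<in> S" for w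
    proof -
      have "\<not> chi E (S - {w}) \<le> card S - 4" using R that le[of "S - {w}"] assms by blast
      moreover have "chi E (S - {w}) \<le> chi E S"
        using clique_like.mono[OF clique_like_chi[OF sym irrefl] assms] .
      ultimately show ?thesis by linarith
    qed
    obtain w where "w \<in> S" using R by fastforce
    show ?L unfolding critical_def
    proof (intro conjI ballI)
      show "chi E S + 2 + 1 = card S" using S W[OF \<open>w \<in> S\<close>] R by linarith
      fix u assume "u \<in> S"
      then show "chi E (S - {u}) + 2 + 1 = card S" using S W[of u] R by linarith
    qed
  }
qed

lemma not_one_colorable:
  assumes "\<not> colorable E S 1"
  shows "\<not> stable E S"
proof
  assume "stable E S"
  then have "proper_on E S (\<lambda>_. 0)" unfolding proper_on_def stable_def by blast
  moreover have "(\<lambda>_. 0 :: nat) ` S \<subseteq> {0}" by auto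
  from card_mono[OF _ this] have "card ((\<lambda>_. 0 :: nat) ` S) \<le> 1" by simp
  ultimately show False using assms unfolding colorable_def by (auto intro: exI[of _ "\<lambda>_. 0"])
qed

text \<open>Removing the only vertex of a colour would save a colour.\<close>
lemma critical_chi_colour_class:
  assumes S: "finite S" and crit: "critical (chi E) 2 S"
    and c: "proper_on E S c" "card (c ` S) \<le> card S - 3" and x: "x \<in> S"
  obtains y where "y \<in> S" "y \<noteq> x" "c y = c x"
proof (rule ccontr)
  assume "\<not> thesis"
  with that have "c ` (S - {x}) \<subseteq> c ` S - {c x}" by auto
  then have "card (c ` (S - {x})) \<le> card (c ` S - {c x})" using S by (intro card_mono) auto
  also have "\<dots> = card (c ` S) - 1" using x by simp
  also have "\<dots> \<le> card S - 4" using c(2) by simp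
  finally have "colorable E (S - {x}) (card S - 4)"
    using c(1) unfolding colorable_def proper_on_def by blast
  then show False using crit x unfolding critical_chi_iff[OF S] by blast
qed

text \<open>Using fewer than \<open>card S - 3\<close> colours would colour every
  \<open>S - {w}\<close> too cheaply, so the number is exact. Together with the second vertex in
  each colour this determines the sizes of the colour classes.\<close>

lemma critical_chi_colouring:
  assumes S: "finite S" and crit: "critical (chi E) 2 S"
  obtains c where "proper_on E S c" "card (c ` S) = card S - 3"
    "\<And>x. x \<in> S \<Longrightarrow> \<exists>y\<in>S. y \<noteq> x \<and> c y = c x"
proof -
  have m: "4 \<le> card S" "colorable E S (card S - 3)"
    and not: "\<And>w. w \<in> S \<Longrightarrow> \<not> colorable E (S - {w}) (card S - 4)"
    using crit unfolding critical_chi_iff[OF S] by auto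
  obtain c where c: "proper_on E S c" "card (c ` S) \<le> card S - 3"
    using m(2) unfolding colorable_def by blast
  obtain w where w: "w \<in> S" using m(1) by fastforce
  have "\<not> card (c ` S) \<le> card S - 4"
  proof
    assume "card (c ` S) \<le> card S - 4"
    then have "colorable E S (card S - 4)" using c(1) unfolding colorable_def by blast
    then have "colorable E (S - {w}) (card S - 4)" using S colorable_subset by blast
    with not[OF w] show False ..
  qed
  with c(2) have "card (c ` S) = card S - 3" by linarith
  moreover have "\<exists>y\<in>S. y \<noteq> x \<and> c y = c x" if "x \<in> S" for x
    using critical_chi_colour_class[OF S crit c that] by metis
  ultimately show thesis using that c(1) by blast
qed

lemma critical_chi_card_le:
  assumes S: "finite S" and crit: "critical (chi E) 2 S"
  shows "card S \<le> 6"
proof -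
  obtain c where c: "proper_on E S c" "card (c ` S) = card S - 3"
    and mate: "\<And>x. x \<in> S \<Longrightarrow> \<exists>y\<in>S. y \<noteq> x \<and> c y = c x"
    using critical_chi_colouring[OF assms] by metis
  have "2 \<le> card {x \<in> S. c x = k}" if k: "k \<in> c ` S" for k
  proof -
    obtain x where x: "x \<in> S" "c x = k" using k by blast
    obtain y where "y \<in> S" "y \<noteq> x" "c y = c x" using mate[OF x(1)] by blast
    then have "card {x, y} \<le> card {x \<in> S. c x = k}" using x S by (intro card_mono) auto
    with \<open>y \<noteq> x\<close> show ?thesis by simp
  qed
  then have "card (c ` S) * 2 \<le> (\<Sum>k\<in>c ` S. card {x \<in> S. c x = k})"
    using sum_bounded_below[of "c ` S" 2 "\<lambda>k. card {x \<in> S. c x = k}"] by simp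
  also have "\<dots> = card S"
    using sum.image_gen[OF S, of "\<lambda>_. 1 :: nat" c] by simp
  finally show ?thesis using c(2) by linarith
qed

lemma critical_chi_4:
  assumes S: "card S = 4" and crit: "critical (chi E) 2 S"
  shows "stable E S"
proof -
  have fin: "finite S" using S card.infinite by fastforce
  obtain c where c: "proper_on E S c" "card (c ` S) = 1"
    using critical_chi_colouring[OF fin crit] S by auto
  then obtain k where "c ` S = {k}" by (auto simp: card_1_singleton_iff)
  with c(1) show ?thesis unfolding proper_on_def stable_def by (metis image_eqI singletonD)
qed

text \<open>The colour classes have two and three vertices. No single vertex meets all edges, so
  Koenig's theorem for this bipartite graph promises two disjoint edges; here it is a propositional
  consequence of the five deletions.\<close>

lemma critical_chi_5:
  assumes S: "card S = 5" and crit: "critical (chi E) 2 S"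
  obtains p q r s t where "distinct [p, q, r, s, t]" "S = {p, q, r, s, t}"
    "stable E {p, q}" "stable E {r, s, t}" "(p, r) \<in> E" "(q, s) \<in> E"
proof -
  have fin: "finite S" using S card.infinite by fastforce
  obtain c where c: "proper_on E S c" "card (c ` S) = 2"
    and mate: "\<And>x. x \<in> S \<Longrightarrow> \<exists>y\<in>S. y \<noteq> x \<and> c y = c x"
    using critical_chi_colouring[OF fin crit] S by auto
  obtain k l where kl: "c ` S = {k, l}" "k \<noteq> l" using c(2) by (auto simp: card_2_iff)
  obtain x where x: "x \<in> S" "c x = k" using kl by (metis image_iff insertI1)
  obtain z where z: "z \<in> S" "c z = l" using kl by (metis image_iff insertI1 insertI2)
  obtain y where y: "y \<in> S" "y \<noteq> x" "c y = k" using mate[OF x(1)] x by auto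
  obtain w where w: "w \<in> S" "w \<noteq> z" "c w = l" using mate[OF z(1)] z by auto
  have dist: "distinct [x, y, z, w]" using x y z w kl(2) by auto
  then have "card (S - {x, y, z, w}) = 1"
    using S x y z w by (subst card_Diff_subset) auto
  then obtain t where t: "S - {x, y, z, w} = {t}" by (auto simp: card_1_singleton_iff)
  then have Seq: "S = {x, y, z, w, t}" "t \<notin> {x, y, z, w}" using x y z w by auto
  \<comment> \<open>The fifth vertex decides which of the two classes has three elements.\<close>
  then have ct: "c t = k \<or> c t = l" using kl by blast
  have ind: "stable E A" if "A \<subseteq> S" "\<forall>u\<in>A. c u = i" for A i
    unfolding stable_def
  proof (intro ballI)
    fix u v assume "u \<in> A" "v \<in> A"
    with that have "u \<in> S" "v \<in> S" "c u = c v" by auto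
    then show "(u, v) \<notin> E" using c(1) unfolding proper_on_def by blast
  qed
  have "\<exists>p q r s t. distinct [p, q, r, s, t] \<and> S = {p, q, r, s, t} \<and>
    stable E {p, q} \<and> stable E {r, s, t}"
    using ct
  proof
    assume "c t = k"
    then have "stable E {z, w}" "stable E {x, y, t}"
      using ind[of "{z, w}" l] ind[of "{x, y, t}" k] x y z w Seq(1) by auto
    moreover have "distinct [z, w, x, y, t]" using dist Seq(2) by auto
    moreover have "S = {z, w, x, y, t}" using Seq(1) by auto
    ultimately show ?thesis by blast
  next
    assume "c t = l"
    then have "stable E {x, y}" "stable E {z, w, t}"
      using ind[of "{x, y}" k] ind[of "{z, w, t}" l] x y z w Seq(1) by auto
    moreover have "distinct [x, y, z, w, t]" using dist Seq(2) by auto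
    moreover have "S = {x, y, z, w, t}" using Seq(1) by auto
    ultimately show ?thesis by blast
  qed
  then obtain p q r s t where d: "distinct [p, q, r, s, t]" and Sp: "S = {p, q, r, s, t}"
    and i: "stable E {p, q}" "stable E {r, s, t}" by blast
  have W: "\<not> stable E (S - {u})" if "u \<in> S" for u
    using crit that S not_one_colorable unfolding critical_chi_iff[OF fin] by simp
  have "(q, r) \<in> E \<or> (q, s) \<in> E \<or> (q, t) \<in> E"
    using W[of p] d i unfolding Sp stable_def by (auto simp: symE)
  moreover have "(p, r) \<in> E \<or> (p, s) \<in> E \<or> (p, t) \<in> E"
    using W[of q] d i unfolding Sp stable_def by (auto simp: symE)
  moreover have "(p, s) \<in> E \<or> (p, t) \<in> E \<or> (q, s) \<in> E \<or> (q, t) \<in> E"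
    using W[of r] d i unfolding Sp stable_def by (auto simp: symE)
  moreover have "(p, r) \<in> E \<or> (p, t) \<in> E \<or> (q, r) \<in> E \<or> (q, t) \<in> E"
    using W[of s] d i unfolding Sp stable_def by (auto simp: symE)
  moreover have "(p, r) \<in> E \<or> (p, s) \<in> E \<or> (q, r) \<in> E \<or> (q, s) \<in> E"
    using W[of t] d i unfolding Sp stable_def by (auto simp: symE)
  ultimately consider "(p, r) \<in> E" "(q, s) \<in> E" | "(p, r) \<in> E" "(q, t) \<in> E"
    | "(p, s) \<in> E" "(q, r) \<in> E" | "(p, s) \<in> E" "(q, t) \<in> E"
    | "(p, t) \<in> E" "(q, r) \<in> E" | "(p, t) \<in> E" "(q, s) \<in> E" by argo
  then show thesis
    using that[of p q r s t] that[of p q r t s] that[of p q s r t] that[of p q s t r]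
      that[of p q t r s] that[of p q t s r] d i Sp
    by cases (auto simp: insert_commute)
qed

lemma critical_chi_6:
  assumes S: "card S = 6" and crit: "critical (chi E) 2 S"
  obtains a a' b b' c c' where "distinct [a, a', b, b', c, c']" "S = {a, a', b, b', c, c'}"
    "(a, a') \<notin> E" "(b, b') \<notin> E" "(c, c') \<notin> E"
proof -
  have fin: "finite S" using S card.infinite by fastforce
  obtain f where f: "proper_on E S f" "card (f ` S) = 3"
    and mate: "\<And>x. x \<in> S \<Longrightarrow> \<exists>y\<in>S. y \<noteq> x \<and> f y = f x"
    using critical_chi_colouring[OF fin crit] S by auto
  obtain i j k where ijk: "f ` S = {i, j, k}" "i \<noteq> j" "i \<noteq> k" "j \<noteq> k"
    using f(2) by (auto simp: card_3_iff)
  have pick: "\<exists>x y. x \<in> S \<and> y \<in> S \<and> x \<noteq> y \<and> f x = l \<and> f y = l \<and> (x, y) \<notin> E" if "l \<in> f ` S" for l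
  proof -
    obtain x where "x \<in> S" "f x = l" using \<open>l \<in> f ` S\<close> by blast
    moreover from mate[OF this(1)] obtain y where "y \<in> S" "y \<noteq> x" "f y = f x" by blast
    ultimately show ?thesis using f(1) unfolding proper_on_def by metis
  qed
  obtain a a' where a: "a \<in> S" "a' \<in> S" "a \<noteq> a'" "f a = i" "f a' = i" "(a, a') \<notin> E"
    using pick[of i] ijk by blast
  obtain b b' where b: "b \<in> S" "b' \<in> S" "b \<noteq> b'" "f b = j" "f b' = j" "(b, b') \<notin> E"
    using pick[of j] ijk by blast
  obtain c c' where c: "c \<in> S" "c' \<in> S" "c \<noteq> c'" "f c = k" "f c' = k" "(c, c') \<notin> E"
    using pick[of k] ijk by blast
  \<comment> \<open>Three disjoint pairs of equally coloured vertices exhaust a set of six.\<close>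
  have dist: "distinct [a, a', b, b', c, c']" using a b c ijk by auto
  then have "card (set [a, a', b, b', c, c']) = 6" by (subst distinct_card) auto
  then have "set [a, a', b, b', c, c'] = S"
    using S fin a b c by (intro card_subset_eq) auto
  then show thesis using that dist a b c by auto
qed

text \<open>Deleting a cycle vertex leaves a path, whose 2-colouring must not extend to
  \<open>w\<close>. As \<open>w\<close> misses \<open>e\<close>, adding it to the side
  \<open>{c, e}\<close> after deleting \<open>a\<close>, or to \<open>{b, e}\<close> after deleting
  \<open>d\<close>, can fail only because of \<open>c\<close> or \<open>b\<close> respectively.
  After deleting \<open>b\<close>, the side \<open>{a, d}\<close> shows that \<open>w\<close> meets
  \<open>a\<close> or \<open>d\<close>.\<close>

lemma pentagon_plus_vertex:
  assumes p: "pentagon E a b c d e" and w: "w \<notin> {a, b, c, d, e}" "(w, e) \<notin> E"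
    and col: "\<And>u. u \<in> {a, b, c, d, e} \<Longrightarrow> \<not> colorable E ({a, b, c, d, e, w} - {u}) 2"
  shows "digraph_iso (with_proj (induced E {a, b, c, d, e, w})) (with_proj (C5_plus 3)) \<or>
    digraph_iso (with_proj (induced E {a, b, c, d, e, w})) (with_proj (C5_plus 4))"
proof -
  let ?S = "{a, b, c, d, e, w}"
  note nc = not_two_colorable[OF col]
  have wc: "(w, c) \<in> E"
    using nc[of a "{b, d}" "{c, e, w}"] p w unfolding pentagon_def stable_def by (auto simp: symE)
  have wb: "(w, b) \<in> E"
    using nc[of d "{a, c}" "{b, e, w}"] p w unfolding pentagon_def stable_def by (auto simp: symE)
  have wad: "(w, a) \<in> E \<or> (w, d) \<in> E"
    using nc[of b "{c, e}" "{a, d, w}"] p w unfolding pentagon_def stable_def by (auto simp: symE)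
  then consider "(w, a) \<in> E" "(w, d) \<in> E" | "(w, a) \<in> E" "(w, d) \<notin> E" | "(w, a) \<notin> E" "(w, d) \<in> E" by blast
  then show ?thesis
  proof cases
    case 1
    then show ?thesis using p w wb wc unfolding iso_C5_plus_4_iff by blast
  next
    case 2
    then show ?thesis using p w wb wc unfolding iso_C5_plus_3_iff by blast
  next
    case 3
    \<comment> \<open>The neighbours \<open>b\<close>, \<open>c\<close>, \<open>d\<close> of
      \<open>w\<close> are again consecutive; one rotation moves them to the first three
      places.\<close>
    have "pentagon E b c d e a" using p unfolding pentagon_def by auto
    moreover have "?S = {b, c, d, e, a, w}" by auto
    ultimately show ?thesis using 3 w wb wc unfolding iso_C5_plus_3_iff by blast
  qed
qed

section \<open>Triangles in subgraphs of the octahedron\<close>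

definition triangle :: "'a \<Rightarrow> 'a \<Rightarrow> 'a \<Rightarrow> bool" where
  "triangle x y z \<longleftrightarrow> (x, y) \<in> E \<and> (y, z) \<in> E \<and> (x, z) \<in> E"

definition disjoint_triangles :: "'a set \<Rightarrow> bool" where
  "disjoint_triangles S \<longleftrightarrow> (\<exists>u v w x y z. distinct [u, v, w, x, y, z] \<and>
    S = {u, v, w, x, y, z} \<and> triangle u v w \<and> triangle x y z)"

text \<open>The central triangle is \<open>a b c\<close>, and \<open>a'\<close>, \<open>b'\<close>,
  \<open>c'\<close> sit on its sides opposite \<open>a\<close>, \<open>b\<close>, \<open>c\<close>.
  An edge between two outer vertices, say \<open>a'\<close> and \<open>b'\<close>, would create the
  disjoint triangles \<open>a' b' c\<close> and \<open>a b c'\<close>.\<close>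

lemma three_sunI:
  assumes d: "distinct [a, a', b, b', c, c']" and S: "S = {a, a', b, b', c, c'}"
    and ne: "(a, a') \<notin> E" "(b, b') \<notin> E" "(c, c') \<notin> E"
    and t: "triangle a' b c" "triangle a b' c" "triangle a b c'"
    and no: "\<not> disjoint_triangles S"
  shows "digraph_iso (with_proj (induced E S)) (with_proj three_sun)"
proof -
  have no2: "\<not> (triangle u v w \<and> triangle x y z)"
    if "distinct [u, v, w, x, y, z]" "S = {u, v, w, x, y, z}" for u v w x y z
    using no that unfolding disjoint_triangles_def by blast
  have e: "(a', b) \<in> E" "(b, c) \<in> E" "(a', c) \<in> E" "(a, b') \<in> E" "(b', c) \<in> E" "(a, c) \<in> E"
    "(a, b) \<in> E" "(b, c') \<in> E" "(a, c') \<in> E"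
    using t unfolding triangle_def by auto
  have n1: "(a', b') \<notin> E"
    using no2[of a' b' c a b c'] d e S unfolding triangle_def by auto
  have n2: "(b', c') \<notin> E"
    using no2[of a b' c' a' b c] d e S unfolding triangle_def by auto
  have n3: "(a', c') \<notin> E"
    using no2[of a' b c' a b' c] d e S unfolding triangle_def by auto
  have f: "distinct [a, b, c, c', a', b']" "S = {a, b, c, c', a', b'}"
    using d S by auto
  show ?thesis
    unfolding iso_three_sun_iff
    by (rule exI[of _ a], rule exI[of _ b], rule exI[of _ c],
        rule exI[of _ c'], rule exI[of _ a'], rule exI[of _ b'])
      (use e ne n1 n2 n3 f in \<open>simp add: symE\<close>)
qed

text \<open>A face picks one vertex from each pair, so faces correspond to corners of a cube. The
  triangles present meet every side of the cube, because each vertex is avoided, and no two are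
  antipodal, because none are disjoint. Such a set of corners contains the three neighbours of some
  corner, and that corner is the central triangle of the sun.\<close>

lemma octahedron_subgraph_triangles:
  assumes d: "distinct [a, a', b, b', c, c']" and S: "S = {a, a', b, b', c, c'}"
    and ne: "(a, a') \<notin> E" "(b, b') \<notin> E" "(c, c') \<notin> E"
    and tri: "\<And>w. w \<in> S \<Longrightarrow> \<exists>x\<in>S - {w}. \<exists>y\<in>S - {w}. \<exists>z\<in>S - {w}. triangle x y z"
    and no: "\<not> disjoint_triangles S"
  shows "digraph_iso (with_proj (induced E S)) (with_proj three_sun)"
proof -
  have perm: "triangle y x z \<longleftrightarrow> triangle x y z" "triangle x z y \<longleftrightarrow> triangle x y z" for x y z
    unfolding triangle_def using symE by blast+
  have hit: "\<exists>x\<in>{a, a'} - {w}. \<exists>y\<in>{b, b'} - {w}. \<exists>z\<in>{c, c'} - {w}. triangle x y z"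
    if w: "w \<in> S" for w
  proof -
    obtain x y z where xyz: "x \<in> S - {w}" "y \<in> S - {w}" "z \<in> S - {w}" "triangle x y z"
      using tri[OF w] by blast
    let ?A = "{a, a'} - {w}" and ?B = "{b, b'} - {w}" and ?C = "{c, c'} - {w}"
    \<comment> \<open>Adjacent vertices come from different pairs, so a triangle takes one vertex of
      each pair, in one of six orders.\<close>
    have "p \<notin> {a, a'} \<or> q \<notin> {a, a'}" "p \<notin> {b, b'} \<or> q \<notin> {b, b'}" "p \<notin> {c, c'} \<or> q \<notin> {c, c'}"
      if "(p, q) \<in> E" for p q using that ne symE by auto
    note excl = this
    have "x \<in> {a, a'} \<or> x \<in> {b, b'} \<or> x \<in> {c, c'}" "y \<in> {a, a'} \<or> y \<in> {b, b'} \<or> y \<in> {c, c'}"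
      "z \<in> {a, a'} \<or> z \<in> {b, b'} \<or> z \<in> {c, c'}" using xyz(1-3) S by auto
    moreover have "(x, y) \<in> E" "(y, z) \<in> E" "(x, z) \<in> E" using xyz(4) unfolding triangle_def by auto
    note excl[OF this(1)] excl[OF this(2)] excl[OF this(3)]
    ultimately consider "x \<in> {a, a'} \<and> y \<in> {b, b'} \<and> z \<in> {c, c'}" | "x \<in> {a, a'} \<and> z \<in> {b, b'} \<and> y \<in> {c, c'}"
      | "y \<in> {a, a'} \<and> x \<in> {b, b'} \<and> z \<in> {c, c'}" | "y \<in> {a, a'} \<and> z \<in> {b, b'} \<and> x \<in> {c, c'}"
      | "z \<in> {a, a'} \<and> x \<in> {b, b'} \<and> y \<in> {c, c'}" | "z \<in> {a, a'} \<and> y \<in> {b, b'} \<and> x \<in> {c, c'}"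
      by argo
    then have "x \<in> ?A \<and> y \<in> ?B \<and> z \<in> ?C \<or> x \<in> ?A \<and> z \<in> ?B \<and> y \<in> ?C
      \<or> y \<in> ?A \<and> x \<in> ?B \<and> z \<in> ?C \<or> y \<in> ?A \<and> z \<in> ?B \<and> x \<in> ?C
      \<or> z \<in> ?A \<and> x \<in> ?B \<and> y \<in> ?C \<or> z \<in> ?A \<and> y \<in> ?B \<and> x \<in> ?C"
      using xyz(1-3) by cases simp_all
    moreover have "triangle x z y" "triangle y x z" "triangle y z x" "triangle z x y" "triangle z y x"
      using xyz(4) perm by metis+
    ultimately show ?thesis using xyz(4) by (elim disjE conjE) (rule bexI, rule bexI, rule bexI, assumption+)+
  qed
  have no2: "\<not> (triangle u v w \<and> triangle x y z)"
    if "distinct [u, v, w, x, y, z]" "S = {u, v, w, x, y, z}" for u v w x y z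
    using no that unfolding disjoint_triangles_def by blast
  \<comment> \<open>One clause for each of the six sides of the cube, then one for each of the four
    pairs of antipodal corners.\<close>
  have "triangle a b c \<or> triangle a b c' \<or> triangle a b' c \<or> triangle a b' c'"
    using hit[of "a'"] d S by auto
  moreover have "triangle a' b c \<or> triangle a' b c' \<or> triangle a' b' c \<or> triangle a' b' c'"
    using hit[of "a"] d S by auto
  moreover have "triangle a b c \<or> triangle a b c' \<or> triangle a' b c \<or> triangle a' b c'"
    using hit[of "b'"] d S by auto
  moreover have "triangle a b' c \<or> triangle a b' c' \<or> triangle a' b' c \<or> triangle a' b' c'"
    using hit[of "b"] d S by auto
  moreover have "triangle a b c \<or> triangle a b' c \<or> triangle a' b c \<or> triangle a' b' c"
    using hit[of "c'"] d S by auto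
  moreover have "triangle a b c' \<or> triangle a b' c' \<or> triangle a' b c' \<or> triangle a' b' c'"
    using hit[of "c"] d S by auto
  moreover have "\<not> (triangle a b c \<and> triangle a' b' c')" using no2[of a b c a' b' c'] d S by auto
  moreover have "\<not> (triangle a b c' \<and> triangle a' b' c)" using no2[of a b c' a' b' c] d S by auto
  moreover have "\<not> (triangle a b' c \<and> triangle a' b c')" using no2[of a b' c a' b c'] d S by auto
  moreover have "\<not> (triangle a b' c' \<and> triangle a' b c)" using no2[of a b' c' a' b c] d S by auto
  \<comment> \<open>Each case lists the three faces sharing an edge with a fourth. That fourth face
    is \<open>a b c\<close>, \<open>a b c'\<close>, \<open>a b' c\<close>, \<open>a b' c'\<close> in
    the first four cases, and the same with \<open>a'\<close> for \<open>a\<close> in the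
    others.\<close>
  ultimately consider "triangle a' b c" "triangle a b' c" "triangle a b c'" |
    "triangle a' b c'" "triangle a b' c'" "triangle a b c" |
    "triangle a' b' c" "triangle a b c" "triangle a b' c'" |
    "triangle a' b' c'" "triangle a b c'" "triangle a b' c" |
    "triangle a b c" "triangle a' b' c" "triangle a' b c'" |
    "triangle a b c'" "triangle a' b' c'" "triangle a' b c" |
    "triangle a b' c" "triangle a' b c" "triangle a' b' c'" |
    "triangle a b' c'" "triangle a' b c'" "triangle a' b' c"
    by argo
  then show ?thesis
  proof cases
    case 1
    show ?thesis by (rule three_sunI[of a a' b b' c c']) (use 1 d S ne no in \<open>auto simp: symE insert_commute\<close>)
  next
    case 2
    show ?thesis by (rule three_sunI[of a a' b b' c' c]) (use 2 d S ne no in \<open>auto simp: symE insert_commute\<close>)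
  next
    case 3
    show ?thesis by (rule three_sunI[of a a' b' b c c']) (use 3 d S ne no in \<open>auto simp: symE insert_commute\<close>)
  next
    case 4
    show ?thesis by (rule three_sunI[of a a' b' b c' c]) (use 4 d S ne no in \<open>auto simp: symE insert_commute\<close>)
  next
    case 5
    show ?thesis by (rule three_sunI[of a' a b b' c c']) (use 5 d S ne no in \<open>auto simp: symE insert_commute\<close>)
  next
    case 6
    show ?thesis by (rule three_sunI[of a' a b b' c' c]) (use 6 d S ne no in \<open>auto simp: symE insert_commute\<close>)
  next
    case 7
    show ?thesis by (rule three_sunI[of a' a b' b c c']) (use 7 d S ne no in \<open>auto simp: symE insert_commute\<close>)
  next
    case 8
    show ?thesis by (rule three_sunI[of a' a b' b c' c]) (use 8 d S ne no in \<open>auto simp: symE insert_commute\<close>)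
  qed
qed

lemma critical_chi_cases:
  assumes S: "finite S" and crit: "critical (chi E) 2 S"
  shows "card S = 4 \<and> stable E S \<or> card S = 5 \<or> card S = 6 \<and>
    (disjoint_triangles S \<or> digraph_iso (with_proj (induced E S)) (with_proj three_sun) \<or>
     digraph_iso (with_proj (induced E S)) (with_proj (C5_plus 3)) \<or>
     digraph_iso (with_proj (induced E S)) (with_proj (C5_plus 4)))"
proof -
  have m: "4 \<le> card S" and not: "\<And>w. w \<in> S \<Longrightarrow> \<not> colorable E (S - {w}) (card S - 4)"
    using crit unfolding critical_chi_iff[OF S] by auto
  have "card S \<le> 6" using critical_chi_card_le[OF S crit] .
  with m consider "card S = 4" | "card S = 5" | "card S = 6" by linarith
  then show ?thesis
  proof cases
    case 1
    then show ?thesis using critical_chi_4 crit by blast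
  next
    case 2
    then show ?thesis by blast
  next
    case 3
    obtain a a' b b' c c' where d: "distinct [a, a', b, b', c, c']" and Seq: "S = {a, a', b, b', c, c'}"
      and ne: "(a, a') \<notin> E" "(b, b') \<notin> E" "(c, c') \<notin> E"
      using critical_chi_6[OF 3 crit] by blast
    have col: "\<not> colorable E (S - {w}) 2" if "w \<in> S" for w using not[OF that] 3 by simp
    show ?thesis
    proof (cases "\<forall>w\<in>S. \<exists>x\<in>S - {w}. \<exists>y\<in>S - {w}. \<exists>z\<in>S - {w}. triangle x y z")
      case True
      then show ?thesis using octahedron_subgraph_triangles[OF d Seq ne] 3 by blast
    next
      case False
      then obtain w where w: "w \<in> S" and no: "\<And>x y z. x \<in> S - {w} \<Longrightarrow> y \<in> S - {w} \<Longrightarrow> z \<in> S - {w} \<Longrightarrow>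
        \<not> triangle x y z" by blast
      have "card (S - {w}) = 5" using 3 w S by simp
      moreover have "(z, x) \<notin> E" if "x \<in> S - {w}" "y \<in> S - {w}" "z \<in> S - {w}" "(x, y) \<in> E" "(y, z) \<in> E" for x y z
        using no[OF that(1-3)] that(4,5) unfolding triangle_def by (simp add: symE)
      ultimately obtain p q r s t where pent: "pentagon E p q r s t" and Sw: "S - {w} = {p, q, r, s, t}"
        using pentagon_of_triangle_free[of "S - {w}"] col[OF w] S by blast
      \<comment> \<open>The witness is the partner of \<open>w\<close> in its non-adjacent pair. The
        pentagon is then rotated until this non-neighbour comes last.\<close>
      have "\<exists>u\<in>S - {w}. (w, u) \<notin> E"
      proof -
        have "(a', a) \<notin> E" "(b', b) \<notin> E" "(c', c) \<notin> E" using ne symE by auto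
        moreover have "w \<in> {a, a', b, b', c, c'}" using w Seq by simp
        ultimately show ?thesis using d ne unfolding Seq by auto
      qed
      then obtain u where "u \<in> S - {w}" "(w, u) \<notin> E" by blast
      then obtain p q r s t where p: "pentagon E p q r s t" "S - {w} = {p, q, r, s, t}" "(w, t) \<notin> E"
      proof -
        have "pentagon E q r s t p" "pentagon E r s t p q" "pentagon E s t p q r" "pentagon E t p q r s"
          using pent unfolding pentagon_def by auto
        moreover have "{p, q, r, s, t} = {q, r, s, t, p}" "{p, q, r, s, t} = {r, s, t, p, q}"
          "{p, q, r, s, t} = {s, t, p, q, r}" "{p, q, r, s, t} = {t, p, q, r, s}" by auto
        ultimately show thesis
          using that pent Sw \<open>u \<in> S - {w}\<close> \<open>(w, u) \<notin> E\<close> by (metis emptyE insertE)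
      qed
      have Sp: "S = {p, q, r, s, t, w}" and wn: "w \<notin> {p, q, r, s, t}" using p(2) w by auto
      show ?thesis
        using pentagon_plus_vertex[OF p(1) wn p(3)] col 3 unfolding Sp by blast
    qed
  qed
qed

section \<open>The listed structures are critical\<close>

lemma critical_chi_4I:
  assumes "card S = 4" "stable E S"
  shows "critical (chi E) 2 S"
proof -
  have fin: "finite S" using assms card.infinite by fastforce
  have "proper_on E S (\<lambda>_. 0)" using assms unfolding proper_on_def stable_def by blast
  moreover have "(\<lambda>_. 0 :: nat) ` S \<subseteq> {0}" by auto
  from card_mono[OF _ this] have "card ((\<lambda>_. 0 :: nat) ` S) \<le> 1" by simp
  ultimately have "colorable E S 1" unfolding colorable_def by (intro exI[of _ "\<lambda>_. 0"]) simp
  moreover have "\<not> colorable E (S - {w}) 0" if "w \<in> S" for w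
  proof -
    have "card (S - {w}) = 3" using assms that fin by simp
    then have "S - {w} \<noteq> {}" by force
    then show ?thesis using fin unfolding colorable_def by auto
  qed
  ultimately show ?thesis using assms fin by (simp add: critical_chi_iff)
qed

text \<open>The two edges are disjoint, so every deletion leaves one of them intact and a single
  colour fails.\<close>

lemma critical_chi_5I:
  assumes S: "card S = 5" "colorable E S 2" and e: "distinct [p, q, r, s]" "{p, q, r, s} \<subseteq> S" "(p, q) \<in> E" "(r, s) \<in> E"
  shows "critical (chi E) 2 S"
proof -
  have fin: "finite S" using S card.infinite by fastforce
  have "\<not> colorable E (S - {w}) 1" if "w \<in> S" for w
  proof
    assume "colorable E (S - {w}) 1"
    moreover have "clique E {p, q}" "clique E {r, s}" using e unfolding clique_def by (auto simp: symE)
    moreover have "{p, q} \<subseteq> S - {w} \<or> {r, s} \<subseteq> S - {w}" using e by auto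
    ultimately have "card {p, q} \<le> 1 \<or> card {r, s} \<le> 1"
      using clique_card_le_colorable fin by blast
    then show False using e by auto
  qed
  then show ?thesis using S fin by (simp add: critical_chi_iff)
qed

lemma triangle_clique:
  assumes "triangle x y z"
  shows "clique E {x, y, z}" "card {x, y, z} = 3"
  using assms irreflE unfolding triangle_def clique_def by (auto simp: symE card_insert_if)

lemma disjoint_triangles_avoid:
  assumes "disjoint_triangles S"
  obtains Q where "Q \<subseteq> S - {w}" "clique E Q" "card Q = 3"
proof -
  obtain u v t x y z where d: "distinct [u, v, t, x, y, z]" "S = {u, v, t, x, y, z}"
    and t: "triangle u v t" "triangle x y z"
    using assms unfolding disjoint_triangles_def by blast
  have "{u, v, t} \<subseteq> S - {w} \<or> {x, y, z} \<subseteq> S - {w}" using d by auto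
  then show thesis
    using that[of "{u, v, t}"] that[of "{x, y, z}"] triangle_clique[OF t(1)] triangle_clique[OF t(2)] by blast
qed

text \<open>The three triangles through the outer vertices have no common vertex.\<close>

lemma three_sun_avoid:
  assumes "digraph_iso (with_proj (induced E S)) (with_proj three_sun)"
  obtains Q where "Q \<subseteq> S - {w}" "clique E Q" "card Q = 3"
proof -
  obtain a b c x y z where d: "distinct [a, b, c, x, y, z]" "S = {a, b, c, x, y, z}"
    and "triangle x a b" "triangle y b c" "triangle z c a"
    using assms unfolding iso_three_sun_iff triangle_def by (auto simp: symE)
  note t = triangle_clique[OF this(3)] triangle_clique[OF this(4)] triangle_clique[OF this(5)]
  have "{x, a, b} \<subseteq> S - {w} \<or> {y, b, c} \<subseteq> S - {w} \<or> {z, c, a} \<subseteq> S - {w}" using d by auto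
  then show thesis
    using that[of "{x, a, b}"] that[of "{y, b, c}"] that[of "{z, c, a}"] t by blast
qed

lemma critical_chi_6I:
  assumes S: "card S = 6" "colorable E S 3" and c:
    "disjoint_triangles S \<or> digraph_iso (with_proj (induced E S)) (with_proj three_sun) \<or>
     digraph_iso (with_proj (induced E S)) (with_proj (C5_plus 3)) \<or>
     digraph_iso (with_proj (induced E S)) (with_proj (C5_plus 4))"
  shows "critical (chi E) 2 S"
proof -
  have fin: "finite S" using S card.infinite by fastforce
  have cl: "\<not> colorable E T 2" if "clique E Q" "Q \<subseteq> T" "card Q = 3" "T \<subseteq> S" for Q T
    using clique_card_le_colorable[OF that(1,2)] that finite_subset[OF that(4) fin] by fastforce
  have "\<not> colorable E (S - {w}) 2" if w: "w \<in> S" for w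
    using c
  proof (elim disjE)
    assume "disjoint_triangles S"
    then show ?thesis using disjoint_triangles_avoid cl by (metis Diff_subset)
  next
    assume "digraph_iso (with_proj (induced E S)) (with_proj three_sun)"
    then show ?thesis using three_sun_avoid cl by (metis Diff_subset)
  next
    have C5: ?thesis if p: "pentagon E a b c d e" "v \<notin> {a, b, c, d, e}" "S = {a, b, c, d, e, v}"
      "(v, a) \<in> E" "(v, b) \<in> E" "(v, c) \<in> E" "(v, d) \<in> E \<and> (v, e) \<notin> E \<or> (v, d) \<notin> E \<and> (v, e) \<notin> E" for a b c d e v
    proof -
      have t: "triangle v a b" "triangle v b c" using p unfolding pentagon_def triangle_def by auto
      have dist: "distinct [a, b, c, d, e]" using p(1) unfolding pentagon_def by simp
      consider "w = v" | "w = a" | "w = b" | "w = c \<or> w = d \<or> w = e" using w p(3) by auto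
      then show ?thesis
      proof cases
        case 1
        then have "{a, b, c, d, e} \<subseteq> S - {w}" using p by auto
        then show ?thesis using pentagon_not_colorable[OF p(1)] fin by blast
      next
        case 2
        then have "{v, b, c} \<subseteq> S - {w}" using p(2,3) dist by auto
        then show ?thesis using cl[OF triangle_clique(1)[OF t(2)]] triangle_clique(2)[OF t(2)] by blast
      next
        \<comment> \<open>Both \<open>v a b\<close> and \<open>v b c\<close> contain the deleted
          \<open>b\<close>. If \<open>v\<close> meets \<open>d\<close>, the triangle
          \<open>v c d\<close> survives; otherwise \<open>v\<close> takes the place of
          \<open>b\<close> on the cycle.\<close>
        case 3
        show ?thesis
        proof (cases "(v, d) \<in> E")
          case True
          then have tr: "triangle v c d" using p unfolding pentagon_def triangle_def by auto
          have "{v, c, d} \<subseteq> S - {w}" using 3 p(2,3) dist by auto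
          then show ?thesis using cl[OF triangle_clique(1)[OF tr]] triangle_clique(2)[OF tr] by blast
        next
          case False
          then have pv: "pentagon E v c d e a"
            using p unfolding pentagon_def by (auto simp: symE)
          have "{v, c, d, e, a} \<subseteq> S - {w}" using 3 p(2,3) dist by auto
          then show ?thesis using pentagon_not_colorable[OF pv] fin by blast
        qed
      next
        case 4
        then have "{v, a, b} \<subseteq> S - {w}" using p(2,3) dist by auto
        then show ?thesis using cl[OF triangle_clique(1)[OF t(1)]] triangle_clique(2)[OF t(1)] by blast
      qed
    qed
    {
      assume "digraph_iso (with_proj (induced E S)) (with_proj (C5_plus 3))"
      then show ?thesis unfolding iso_C5_plus_3_iff using C5 by blast
    next
      assume "digraph_iso (with_proj (induced E S)) (with_proj (C5_plus 4))"
      then show ?thesis unfolding iso_C5_plus_4_iff using C5 by blast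
    }
  qed
  then show ?thesis using S fin by (simp add: critical_chi_iff)
qed

end

section \<open>Critical sets for the clique number\<close>

context sym_irrefl
begin

text \<open>Cliques witness lower bounds where colourings witness upper ones. So here the bound at
  \<open>S\<close> is the universal statement, and the bounds at each \<open>S - {w}\<close> are the
  existential ones.\<close>

lemma critical_omega_iff:
  assumes "finite S"
  shows "critical (omega E) 2 S \<longleftrightarrow> 4 \<le> card S \<and>
    (\<forall>Q\<subseteq>S. clique E Q \<longrightarrow> card Q \<le> card S - 3) \<and>
    (\<forall>w\<in>S. \<exists>Q\<subseteq>S - {w}. clique E Q \<and> card Q = card S - 3)"
    (is "?L \<longleftrightarrow> ?R")
proof
  have ge: "k \<le> omega E T \<longleftrightarrow> (\<exists>Q\<subseteq>T. clique E Q \<and> card Q = k)" if "finite T" for T k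
    using omega_ge_iff[OF that] .
  {
    assume ?L
    then have c: "omega E S + 3 = card S" "\<And>w. w \<in> S \<Longrightarrow> omega E (S - {w}) + 3 = card S"
      unfolding critical_def by auto
    obtain x where "x \<in> S" using c(1) by fastforce
    then have "1 \<le> omega E S"
      using ge[OF assms, of 1] by (auto simp: clique_def intro!: exI[of _ "{x}"])
    then have "4 \<le> card S" using c(1) by linarith
    moreover have "card Q \<le> card S - 3" if "Q \<subseteq> S" "clique E Q" for Q
    proof -
      have "card Q \<le> omega E S" using ge[OF assms] that by blast
      then show ?thesis using c(1) by linarith
    qed
    moreover have "\<exists>Q\<subseteq>S - {w}. clique E Q \<and> card Q = card S - 3" if "w \<in> S" for w
    proof -
      have "card S - 3 \<le> omega E (S - {w})" using c(2)[OF that] by linarith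
      then show ?thesis using ge[of "S - {w}"] assms by simp
    qed
    ultimately show ?R by blast
  next
    assume R: ?R
    have S: "omega E S \<le> card S - 3"
    proof -
      obtain Q where "Q \<subseteq> S" "clique E Q" "card Q = omega E S"
        using ge[OF assms, of "omega E S"] by auto
      with R show ?thesis by metis
    qed
    have W: "card S - 3 \<le> omega E (S - {w}) \<and> omega E (S - {w}) \<le> omega E S" if "w \<in> S" for w
    proof -
      have "card S - 3 \<le> omega E (S - {w})" using R that ge[of "S - {w}"] assms by simp
      moreover have "omega E (S - {w}) \<le> omega E S"
        using clique_like.mono[OF clique_like_omega[OF sym irrefl] assms] .
      ultimately show ?thesis ..
    qed
    obtain w where "w \<in> S" using R by fastforce
    show ?L unfolding critical_def
    proof (intro conjI ballI)
      show "omega E S + 2 + 1 = card S" using S W[OF \<open>w \<in> S\<close>] R by linarith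
      fix u assume "u \<in> S"
      then show "omega E (S - {u}) + 2 + 1 = card S" using S W[of u] R by linarith
    qed
  }
qed

text \<open>Hajnal's inequality: adding a maximum clique \<open>A\<close> to the family does not decrease the sum,
  since \<open>(A \<inter> \<Union>\<Gamma>) \<union> \<Inter>\<Gamma>\<close> is again a clique.\<close>
lemma maximum_cliques_Inter_Union:
  assumes "finite S" and max: "\<And>Q. Q \<subseteq> S \<Longrightarrow> clique E Q \<Longrightarrow> card Q \<le> q"
    and "finite \<Gamma>" "\<Gamma> \<noteq> {}" "\<And>Q. Q \<in> \<Gamma> \<Longrightarrow> Q \<subseteq> S \<and> clique E Q \<and> card Q = q"
  shows "2 * q \<le> card (\<Inter>\<Gamma>) + card (\<Union>\<Gamma>)"
  using assms(3-5)
proof (induction \<Gamma> rule: finite_ne_induct)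
  case (singleton A)
  then show ?case by simp
next
  case (insert A \<Gamma>)
  let ?I = "\<Inter>\<Gamma>" and ?U = "\<Union>\<Gamma>"
  have A: "A \<subseteq> S" "clique E A" "card A = q" using insert.prems by auto
  have \<Gamma>: "Q \<subseteq> S" "clique E Q" "card Q = q" if "Q \<in> \<Gamma>" for Q using insert.prems that by auto
  have IU: "?I \<subseteq> ?U" and US: "?U \<subseteq> S" using insert.hyps(2) \<Gamma>(1) by auto
  then have fin: "finite A" "finite ?I" "finite ?U"
    using A(1) assms(1) finite_subset by metis+
  have adj: "(u, v) \<in> E" if u: "u \<in> ?U" and v: "v \<in> ?I" and "u \<noteq> v" for u v
  proof -
    obtain Q where "Q \<in> \<Gamma>" "u \<in> Q" using u by blast
    with v \<Gamma>(2)[of Q] \<open>u \<noteq> v\<close> show ?thesis unfolding clique_def by blast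
  qed
  have "clique E (A \<inter> ?U \<union> ?I)"
    unfolding clique_def
  proof (intro ballI impI)
    fix u v assume uv: "u \<in> A \<inter> ?U \<union> ?I" "v \<in> A \<inter> ?U \<union> ?I" "u \<noteq> v"
    then consider "u \<in> A" "v \<in> A" | "u \<in> ?U" "v \<in> ?I" | "v \<in> ?U" "u \<in> ?I" using IU by blast
    then show "(u, v) \<in> E"
    proof cases
      case 1
      then show ?thesis using A(2) uv(3) unfolding clique_def by blast
    next
      case 2
      then show ?thesis using adj uv(3) by blast
    next
      case 3
      then show ?thesis using adj[of v u] uv(3) symE[of u v] by blast
    qed
  qed
  then have "card (A \<inter> ?U \<union> ?I) \<le> q" using A(1) IU US by (intro max) auto
  moreover have "card (A \<inter> ?U) + card ?I = card (A \<inter> ?U \<union> ?I) + card (A \<inter> ?I)"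
    using card_Un_Int[of "A \<inter> ?U" ?I] fin IU by (simp add: Int_absorb1 Int_assoc inf.absorb2)
  moreover have "card A + card ?U = card (A \<union> ?U) + card (A \<inter> ?U)"
    using card_Un_Int[of A ?U] fin by simp
  moreover have "2 * q \<le> card ?I + card ?U" using insert.IH insert.prems by blast
  ultimately show ?case using A(3) by simp
qed

lemma critical_omega_card_le:
  assumes S: "finite S" and crit: "critical (omega E) 2 S"
  shows "card S \<le> 6"
proof -
  have m: "4 \<le> card S" and max: "\<And>Q. Q \<subseteq> S \<Longrightarrow> clique E Q \<Longrightarrow> card Q \<le> card S - 3"
    and avoid: "\<And>w. w \<in> S \<Longrightarrow> \<exists>Q\<subseteq>S - {w}. clique E Q \<and> card Q = card S - 3"
    using crit unfolding critical_omega_iff[OF S] by auto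
  let ?\<Gamma> = "{Q. Q \<subseteq> S \<and> clique E Q \<and> card Q = card S - 3}"
  have "finite ?\<Gamma>" by (rule finite_subset[of _ "Pow S"]) (use S in auto)
  moreover have ne: "?\<Gamma> \<noteq> {}"
  proof -
    obtain w where "w \<in> S" using m by fastforce
    from avoid[OF this] show ?thesis by blast
  qed
  ultimately have "2 * (card S - 3) \<le> card (\<Inter>?\<Gamma>) + card (\<Union>?\<Gamma>)"
    using max by (intro maximum_cliques_Inter_Union[OF S]) auto
  moreover have "\<Inter>?\<Gamma> = {}"
  proof (rule equals0I)
    fix x assume x: "x \<in> \<Inter>?\<Gamma>"
    then have "x \<in> S" using ne by blast
    then obtain Q where Q: "Q \<subseteq> S - {x}" "clique E Q" "card Q = card S - 3" using avoid by metis
    then have "Q \<in> ?\<Gamma>" by auto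
    with x have "x \<in> Q" by (rule InterD)
    with Q(1) show False by auto
  qed
  moreover have "card (\<Union>?\<Gamma>) \<le> card S" using S by (intro card_mono) auto
  ultimately show ?thesis by simp
qed

lemma three_colorable_if_shared_non_neighbour:
  assumes "(a, x) \<notin> E" "(a, y) \<notin> E" "(x, y) \<notin> E" "(b, z) \<notin> E"
  shows "colorable E {a, b, c, x, y, z} 3"
  by (rule three_colorableI[of _ "{a, x, y}" "{b, z}" "{c}"])
    (use assms in \<open>auto simp: stable_def symE\<close>)

text \<open>A triangle and the remaining three vertices can be matched by non-edges, or two of the three share
  their only non-neighbour on the triangle.\<close>
lemma critical_omega_6_colorable:
  assumes S: "card S = 6" and crit: "critical (omega E) 2 S"
  shows "colorable E S 3"
proof -
  have fin: "finite S" using S card.infinite by fastforce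
  have max: "\<And>Q. Q \<subseteq> S \<Longrightarrow> clique E Q \<Longrightarrow> card Q \<le> 3"
    and avoid: "\<And>w. w \<in> S \<Longrightarrow> \<exists>Q\<subseteq>S - {w}. clique E Q \<and> card Q = 3"
    using crit S unfolding critical_omega_iff[OF fin] by auto
  \<comment> \<open>A vertex joined to all others would extend a triangle avoiding it to a clique of
    four.\<close>
  have nondom: "\<exists>v\<in>S - {u}. (u, v) \<notin> E" if u: "u \<in> S" for u
  proof (rule ccontr)
    assume *: "\<not> ?thesis"
    obtain Q where Q: "Q \<subseteq> S - {u}" "clique E Q" "card Q = 3" using avoid[OF u] by blast
    have "clique E (insert u Q)" using * Q by (intro clique_insert sym) auto
    moreover have "card (insert u Q) = 4" using Q fin finite_subset[of Q S] by (subst card_insert_disjoint) auto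
    ultimately show False using max[of "insert u Q"] Q(1) u by auto
  qed
  obtain u where "u \<in> S" using S by fastforce
  then obtain Q where "Q \<subseteq> S - {u}" and Q: "clique E Q" "card Q = 3" using avoid by metis
  then have QS: "Q \<subseteq> S" by auto
  obtain a b c where abc: "Q = {a, b, c}" "distinct [a, b, c]"
    using Q(2) unfolding card_3_iff by auto
  have "card (S - Q) = 3" using S Q QS fin finite_subset by (subst card_Diff_subset) auto
  then obtain x y z where xyz: "S - Q = {x, y, z}" "distinct [x, y, z]"
    unfolding card_3_iff by auto
  have Seq: "S = {a, b, c, x, y, z}" using QS abc(1) xyz(1) by auto
  have d: "distinct [a, b, c, x, y, z]" using abc xyz by auto
  have e: "(a, b) \<in> E" "(b, c) \<in> E" "(a, c) \<in> E" "(b, a) \<in> E" "(c, b) \<in> E" "(c, a) \<in> E"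
    using Q(1) abc unfolding clique_def by auto
  have k4: "\<not> ((p, q) \<in> E \<and> (p, r) \<in> E \<and> (p, s) \<in> E \<and> (q, r) \<in> E \<and> (q, s) \<in> E \<and> (r, s) \<in> E)"
    if "distinct [p, q, r, s]" "{p, q, r, s} \<subseteq> S" for p q r s
  proof
    assume "(p, q) \<in> E \<and> (p, r) \<in> E \<and> (p, s) \<in> E \<and> (q, r) \<in> E \<and> (q, s) \<in> E \<and> (r, s) \<in> E"
    then have "clique E {p, q, r, s}" unfolding clique_def by (auto simp: symE)
    from max[OF that(2) this] show False using that(1) by simp
  qed
  have na: "(a, x) \<notin> E \<or> (a, y) \<notin> E \<or> (a, z) \<notin> E" using nondom[of a] e d unfolding Seq by auto
  have nb: "(b, x) \<notin> E \<or> (b, y) \<notin> E \<or> (b, z) \<notin> E" using nondom[of b] e d unfolding Seq by auto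
  have nc: "(c, x) \<notin> E \<or> (c, y) \<notin> E \<or> (c, z) \<notin> E" using nondom[of c] e d unfolding Seq by auto
  have n: "(a, w) \<notin> E \<or> (b, w) \<notin> E \<or> (c, w) \<notin> E" if "w \<in> {x, y, z}" for w
    using k4[of a b c w] that d e Seq by auto
  note nx = n[of x, simplified] and ny = n[of y, simplified] and nz = n[of z, simplified]
  have matching: "colorable E S 3"
    if "(a, p) \<notin> E" "(b, q) \<notin> E" "(c, r) \<notin> E" "{p, q, r} = {x, y, z}" for p q r
    by (rule three_colorableI[of _ "{a, p}" "{b, q}" "{c, r}"])
      (use that Seq in \<open>auto simp: stable_def symE\<close>)
  have shared: "colorable E S 3"
    if "{i, j, k} = {a, b, c}" "distinct [i, j, k]" "{p, q, r} = {x, y, z}" "distinct [p, q, r]"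
      and "(i, p) \<notin> E \<and> (i, q) \<notin> E \<and> (j, r) \<notin> E \<and>
        (j, p) \<in> E \<and> (k, p) \<in> E \<and> (j, q) \<in> E \<and> (k, q) \<in> E" for i j k p q r
  proof -
    have S': "S = {i, j, k, p, q, r}" using that(1,3) Seq by blast
    have "card {i, j, k, p, q, r} = 6" using S S' by simp
    have "j \<in> {a, b, c}" "k \<in> {a, b, c}" "p \<in> {x, y, z}" "q \<in> {x, y, z}" using that(1,3) by blast+
    then have "distinct [j, k, p, q]" using that(2,4) d by auto
    moreover have "(j, k) \<in> E" using \<open>j \<in> {a, b, c}\<close> \<open>k \<in> {a, b, c}\<close> that(2) e by auto
    \<comment> \<open>Were \<open>p\<close> and \<open>q\<close> adjacent, \<open>j\<close>,
      \<open>k\<close>, \<open>p\<close>, \<open>q\<close> would form a clique of four. Hence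
      \<open>{i, p, q}\<close> can serve as a colour class.\<close>
    ultimately have "(p, q) \<notin> E" using k4[of j k p q] that(5) S' by auto
    then show ?thesis using three_colorable_if_shared_non_neighbour[of i p q j r k] that(5) S' by simp
  qed
  show ?thesis
  proof (rule ccontr)
    assume not: "\<not> ?thesis"
    have m: "\<not> ((a, p) \<notin> E \<and> (b, q) \<notin> E \<and> (c, r) \<notin> E)" if "{p, q, r} = {x, y, z}" for p q r
      using matching[of p q r] not that by blast
    have s: "\<not> ((i, p) \<notin> E \<and> (i, q) \<notin> E \<and> (j, r) \<notin> E \<and>
        (j, p) \<in> E \<and> (k, p) \<in> E \<and> (j, q) \<in> E \<and> (k, q) \<in> E)"
      if "{i, j, k} = {a, b, c}" "distinct [i, j, k]" "{p, q, r} = {x, y, z}" "distinct [p, q, r]" for i j k p q r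
      using shared[OF that] not by blast
    have i: "{b, a, c} = {a, b, c}" "{c, a, b} = {a, b, c}" "distinct [b, a, c]" "distinct [c, a, b]"
      "{x, z, y} = {x, y, z}" "{y, z, x} = {x, y, z}" "distinct [x, z, y]" "distinct [y, z, x]"
      "{y, x, z} = {x, y, z}" "{z, x, y} = {x, y, z}" "{z, y, x} = {x, y, z}"
      using abc(2) xyz(2) by auto
    \<comment> \<open>Hall's condition for the non-edges between the two triples. Every vertex has a
      non-neighbour in the other triple, so a matching can fail only if two of \<open>x\<close>,
      \<open>y\<close>, \<open>z\<close> share their only non-neighbour \<open>i\<close>; the other
      two triangle vertices then miss the third vertex \<open>r\<close>. The instances of
      \<open>m\<close> are the six matchings, those of \<open>s\<close> the nine choices of
      \<open>i\<close> and \<open>r\<close>.\<close>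
    from na nb nc nx ny nz
      m[OF refl] m[OF i(5)] m[OF i(6)] m[OF i(9)] m[OF i(10)] m[OF i(11)]
      s[OF refl abc(2) refl xyz(2)] s[OF refl abc(2) i(5,7)] s[OF refl abc(2) i(6,8)]
      s[OF i(1,3) refl xyz(2)] s[OF i(1,3) i(5,7)] s[OF i(1,3) i(6,8)]
      s[OF i(2,4) refl xyz(2)] s[OF i(2,4) i(5,7)] s[OF i(2,4) i(6,8)]
    show False by argo
  qed
qed

text \<open>A clique of \<open>card S - 3\<close> vertices avoiding \<open>w\<close> rules out
  \<open>card S - 4\<close> colours on \<open>S - {w}\<close>, so it remains to colour
  \<open>S\<close> with \<open>card S - 3\<close> colours. The obstruction appears on five vertices:
  cliques have size at most two there, and a triangle-free graph that is not bipartite is a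
  pentagon.\<close>

lemma critical_chi_of_critical_omega:
  assumes S: "finite S" and crit: "critical (omega E) 2 S"
    and C5: "\<not> digraph_iso (with_proj (induced E S)) (with_proj C5)"
  shows "critical (chi E) 2 S"
proof -
  have m: "4 \<le> card S" and max: "\<And>Q. Q \<subseteq> S \<Longrightarrow> clique E Q \<Longrightarrow> card Q \<le> card S - 3"
    and avoid: "\<And>w. w \<in> S \<Longrightarrow> \<exists>Q\<subseteq>S - {w}. clique E Q \<and> card Q = card S - 3"
    using crit unfolding critical_omega_iff[OF S] by auto
  have "card S \<le> 6" using critical_omega_card_le[OF S crit] .
  with m consider "card S = 4" | "card S = 5" | "card S = 6" by linarith
  then have col: "colorable E S (card S - 3)"
  proof cases
    case 1
    have "stable E S"
      unfolding stable_def
    proof (intro ballI notI)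
      fix u v assume uv: "u \<in> S" "v \<in> S" "(u, v) \<in> E"
      then have "clique E {u, v}" "u \<noteq> v" unfolding clique_def by (auto simp: symE)
      then show False using max[of "{u, v}"] uv 1 by auto
    qed
    from critical_chi_4I[OF 1 this] show ?thesis unfolding critical_chi_iff[OF S] by blast
  next
    case 2
    show ?thesis
    proof (rule ccontr)
      assume not: "\<not> ?thesis"
      have tri: "(z, x) \<notin> E" if "x \<in> S" "y \<in> S" "z \<in> S" "(x, y) \<in> E" "(y, z) \<in> E" for x y z
      proof
        assume "(z, x) \<in> E"
        then have "triangle x y z" using that unfolding triangle_def by (simp add: symE)
        from triangle_clique[OF this] show False using max[of "{x, y, z}"] that 2 by auto
      qed
      have "\<not> colorable E S 2" using not 2 by simp
      then obtain a b c d e where "pentagon E a b c d e" "S = {a, b, c, d, e}"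
      proof (rule pentagon_of_triangle_free[OF S 2])
        show "(z, x) \<notin> E" if "x \<in> S" "y \<in> S" "z \<in> S" "(x, y) \<in> E" "(y, z) \<in> E" for x y z
          using tri[OF that] .
      qed
      then show False using C5 unfolding iso_C5_iff by blast
    qed
  next
    case 3
    then show ?thesis using critical_omega_6_colorable crit by simp
  qed
  have "\<not> colorable E (S - {w}) (card S - 4)" if "w \<in> S" for w
  proof
    assume c: "colorable E (S - {w}) (card S - 4)"
    obtain Q where "Q \<subseteq> S - {w}" "clique E Q" "card Q = card S - 3" using avoid[OF \<open>w \<in> S\<close>] by blast
    with clique_card_le_colorable[OF this(2,1) _ c] S m show False by simp
  qed
  with col m show ?thesis unfolding critical_chi_iff[OF S] by blast
qed

text \<open>The colouring bounds all cliques, so it remains to find large cliques avoiding each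
  vertex. The structures provide a single vertex, one of two disjoint edges, or a triangle. In the
  two excluded graphs some deletion leaves a pentagon, where no clique explains the third
  colour.\<close>

lemma critical_omega_of_critical_chi:
  assumes S: "finite S" and crit: "critical (chi E) 2 S"
    and C5: "\<not> digraph_iso (with_proj (induced E S)) (with_proj (C5_plus 3))"
      "\<not> digraph_iso (with_proj (induced E S)) (with_proj (C5_plus 4))"
  shows "critical (omega E) 2 S"
proof -
  have m: "4 \<le> card S" and col: "colorable E S (card S - 3)"
    using crit unfolding critical_chi_iff[OF S] by auto
  have "\<exists>Q\<subseteq>S - {w}. clique E Q \<and> card Q = card S - 3" if w: "w \<in> S" for w
    using critical_chi_cases[OF S crit]
  proof (elim disjE conjE)
    assume "card S = 4"
    then have "card (S - {w}) = 3" using w S by simp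
    then have "S - {w} \<noteq> {}" by force
    then obtain x where "x \<in> S - {w}" by blast
    then show ?thesis using \<open>card S = 4\<close> by (intro exI[of _ "{x}"]) (auto simp: clique_def)
  next
    assume 5: "card S = 5"
    obtain p q r s t where d: "distinct [p, q, r, s, t]" "S = {p, q, r, s, t}"
      and e: "(p, r) \<in> E" "(q, s) \<in> E"
      using critical_chi_5[OF 5 crit] by metis
    have "clique E {p, r}" "clique E {q, s}" using e unfolding clique_def by (auto simp: symE)
    moreover have "{p, r} \<subseteq> S - {w} \<or> {q, s} \<subseteq> S - {w}" using d by auto
    moreover have "card {p, r} = card S - 3" "card {q, s} = card S - 3" using d 5 by simp_all
    ultimately show ?thesis by blast
  next
    assume "card S = 6" "disjoint_triangles S"
    then show ?thesis using disjoint_triangles_avoid[of S w ?thesis] by simp blast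
  next
    assume "card S = 6" "digraph_iso (with_proj (induced E S)) (with_proj three_sun)"
    then show ?thesis using three_sun_avoid[of S w ?thesis] by simp blast
  qed (use C5 in auto)
  moreover have "card Q \<le> card S - 3" if "Q \<subseteq> S" "clique E Q" for Q
    using clique_card_le_colorable[OF that(2,1) S col] .
  ultimately show ?thesis using m unfolding critical_omega_iff[OF S] by blast
qed

text \<open>Criticality would require a triangle avoiding \<open>w\<close>, that is, inside the
  pentagon.\<close>

lemma pentagon_plus_not_critical_omega:
  assumes p: "pentagon E a b c d e" and S: "S = {a, b, c, d, e, w}" "w \<notin> {a, b, c, d, e}"
  shows "\<not> critical (omega E) 2 S"
proof
  assume "critical (omega E) 2 S"
  moreover have "card S = 6" "finite S" using p S unfolding pentagon_def by auto
  ultimately obtain Q where Q: "Q \<subseteq> S - {w}" "clique E Q" "card Q = 3"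
    using S(1) by (auto simp: critical_omega_iff)
  then obtain x y z where xyz: "Q = {x, y, z}" "distinct [x, y, z]" unfolding card_3_iff by auto
  have "x \<in> {a, b, c, d, e}" "y \<in> {a, b, c, d, e}" "z \<in> {a, b, c, d, e}" using Q(1) xyz(1) S by auto
  moreover have "(x, y) \<in> E" "(y, z) \<in> E" "(x, z) \<in> E" using Q(2) xyz unfolding clique_def by auto
  ultimately show False using p unfolding pentagon_def by (auto simp: symE)
qed

lemma pentagon_not_critical_chi:
  assumes "pentagon E a b c d e" "S = {a, b, c, d, e}"
  shows "\<not> critical (chi E) 2 S"
proof
  assume "critical (chi E) 2 S"
  moreover have "card S = 5" "finite S" using assms unfolding pentagon_def by auto
  ultimately have "colorable E S 2" by (simp add: critical_chi_iff)
  then show False using pentagon_not_colorable[OF assms(1)] assms(2) by auto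
qed

end

section \<open>The characterization\<close>

abbreviation two_K2_K1 :: "((nat + nat) + nat) pair_pre_digraph" where
  "two_K2_K1 \<equiv> disjoint_union (disjoint_union (complete_graph 2) (complete_graph 2)) (complete_graph 1)"

abbreviation two_K3 :: "(nat + nat) pair_pre_digraph" where
  "two_K3 \<equiv> disjoint_union (complete_graph 3) (complete_graph 3)"

lemma complete_graph: "pverts (complete_graph n) = {..<n}"
  "parcs (complete_graph n) = {(i, j). i < n \<and> j < n \<and> i \<noteq> j}"
  unfolding complete_graph_def mk_graph_def by auto

lemma complete_graph_1: "pverts (complete_graph 1) = {0}" "parcs (complete_graph 1) = {}"
  unfolding complete_graph by auto

lemma complete_graph_2: "pverts (complete_graph 2) = {0, 1}" "parcs (complete_graph 2) = {(0, 1), (1, 0)}"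
  unfolding complete_graph by auto

lemma complete_graph_3: "pverts (complete_graph 3) = {0, 1, 2}"
  "parcs (complete_graph 3) = {(0, 1), (1, 0), (0, 2), (2, 0), (1, 2), (2, 1)}"
proof -
  have "i < 3 \<longleftrightarrow> i = 0 \<or> i = 1 \<or> i = 2" for i :: nat by auto
  note lt = this
  show "pverts (complete_graph 3) = {0, 1, 2}" unfolding complete_graph lessThan_def lt by auto
  show "parcs (complete_graph 3) = {(0, 1), (1, 0), (0, 2), (2, 0), (1, 2), (2, 1)}"
    unfolding complete_graph lt by auto
qed

lemma two_K2_K1:
  "pverts two_K2_K1 = {Inl (Inl 0), Inl (Inl 1), Inl (Inr 0), Inl (Inr 1), Inr 0}"
  "parcs two_K2_K1 = {(Inl (Inl 0), Inl (Inl 1)), (Inl (Inl 1), Inl (Inl 0)),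
    (Inl (Inr 0), Inl (Inr 1)), (Inl (Inr 1), Inl (Inr 0))}"
  unfolding disjoint_union_def complete_graph_2 complete_graph_1 by auto

lemma two_K3:
  "pverts two_K3 = {Inl 0, Inl 1, Inl 2, Inr 0, Inr 1, Inr 2}"
  "parcs two_K3 = map_prod Inl Inl ` parcs (complete_graph 3) \<union> map_prod Inr Inr ` parcs (complete_graph 3)"
  unfolding disjoint_union_def complete_graph_3 by auto

lemma complete_bipartite_graph_arcs:
  "pverts (complete_bipartite_graph m n) = {..<m} <+> {..<n}"
  "parcs (complete_bipartite_graph m n) =
    Inl ` {..<m} \<times> Inr ` {..<n} \<union> Inr ` {..<n} \<times> Inl ` {..<m}"
  unfolding complete_bipartite_graph_def mk_graph_def by auto

text \<open>The removed edges join \<open>2 * i\<close> to \<open>2 * i + 1\<close>, so adjacency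
  means different quotients by 2. These quotients later serve as three colours.\<close>

lemma K6_minus_3e:
  "pverts K6_minus_3e = {..<6}"
  "parcs K6_minus_3e = {(i, j). i < 6 \<and> j < 6 \<and> i div 2 \<noteq> j div 2}"
proof -
  show "pverts K6_minus_3e = {..<6}" unfolding K6_minus_3e_def mk_graph_def by simp
  have all6: "(\<forall>i<6. P i) \<longleftrightarrow> P 0 \<and> P 1 \<and> P 2 \<and> P 3 \<and> P 4 \<and> P 5" for P :: "nat \<Rightarrow> bool"
    by (auto simp: numeral_eq_Suc All_less_Suc)
  let ?M = "{(0, 1), (1, 0), (2, 3), (3, 2), (4, 5), (5, 4)} :: (nat \<times> nat) set"
  have "\<forall>i<6. \<forall>j<6. i \<noteq> j \<and> (i, j) \<notin> ?M \<longleftrightarrow> i div 2 \<noteq> j div 2"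
    unfolding all6 by simp
  then have "{(i, j). i < 6 \<and> j < 6 \<and> i \<noteq> j} - ?M = {(i, j). i < 6 \<and> j < 6 \<and> i div 2 \<noteq> j div 2}"
    by blast
  then have "parcs (complete_graph 6) - ?M = {(i, j). i < 6 \<and> j < 6 \<and> i div 2 \<noteq> j div 2}"
    unfolding complete_graph .
  moreover have "{(i, j). i < 6 \<and> j < 6 \<and> i div 2 \<noteq> j div 2}\<inverse> =
      {(i, j). i < 6 \<and> j < 6 \<and> i div 2 \<noteq> j div (2 :: nat)}"
    by auto
  ultimately show "parcs K6_minus_3e = {(i, j). i < 6 \<and> j < 6 \<and> i div 2 \<noteq> j div 2}"
    unfolding K6_minus_3e_def mk_graph_def by simp
qed

context sym_irrefl
begin

lemma contains_spanning_two_K2_K1_iff: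
  "contains_spanning (with_proj (induced E S)) (with_proj two_K2_K1) \<longleftrightarrow>
    (\<exists>p q r s t. distinct [p, q, r, s, t] \<and> S = {p, q, r, s, t} \<and> (p, q) \<in> E \<and> (r, s) \<in> E)"
    (is "?L \<longleftrightarrow> ?R")
proof -
  have wf: "parcs two_K2_K1 \<subseteq> pverts two_K2_K1 \<times> pverts two_K2_K1" unfolding two_K2_K1 by auto
  show ?thesis
  proof
    assume ?L
    then obtain f where f: "bij_betw f (pverts two_K2_K1) S" "\<forall>(i, j)\<in>parcs two_K2_K1. (f i, f j) \<in> E"
      unfolding contains_spanning_iff[OF wf] by blast
    let ?p = "f (Inl (Inl 0))" and ?q = "f (Inl (Inl 1))" and ?r = "f (Inl (Inr 0))" and ?s = "f (Inl (Inr 1))"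
      and ?t = "f (Inr 0)"
    have "distinct [?p, ?q, ?r, ?s, ?t]" "S = {?p, ?q, ?r, ?s, ?t}" "(?p, ?q) \<in> E" "(?r, ?s) \<in> E"
      using f unfolding two_K2_K1 bij_betw_def by (auto simp: inj_on_def)
    then show ?R by blast
  next
    assume ?R
    then obtain p q r s t where d: "distinct [p, q, r, s, t]" "S = {p, q, r, s, t}" and e: "(p, q) \<in> E" "(r, s) \<in> E"
      by blast
    \<comment> \<open>Each copy of an edge is indexed into a two-element list; the isolated vertex
      goes to \<open>t\<close>.\<close>
    let ?f = "case_sum (case_sum (\<lambda>i. [p, q] ! i) (\<lambda>i. [r, s] ! i)) (\<lambda>_. t)"
    have "bij_betw ?f (pverts two_K2_K1) S"
      using d unfolding two_K2_K1 bij_betw_def by (auto simp: inj_on_def)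
    moreover have "\<forall>(i, j)\<in>parcs two_K2_K1. (?f i, ?f j) \<in> E"
      using e unfolding two_K2_K1 by (auto simp: symE)
    ultimately show ?L unfolding contains_spanning_iff[OF wf] by blast
  qed
qed

lemma contains_spanning_two_K3_iff:
  "contains_spanning (with_proj (induced E S)) (with_proj two_K3) \<longleftrightarrow> disjoint_triangles S"
    (is "?L \<longleftrightarrow> ?R")
proof -
  have wf: "parcs two_K3 \<subseteq> pverts two_K3 \<times> pverts two_K3" unfolding two_K3 complete_graph_3 by auto
  show ?thesis
  proof
    assume ?L
    then obtain f where f: "bij_betw f (pverts two_K3) S" "\<forall>(i, j)\<in>parcs two_K3. (f i, f j) \<in> E"
      unfolding contains_spanning_iff[OF wf] by blast
    let ?u = "f (Inl 0)" and ?v = "f (Inl 1)" and ?w = "f (Inl 2)"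
      and ?x = "f (Inr 0)" and ?y = "f (Inr 1)" and ?z = "f (Inr 2)"
    have "distinct [?u, ?v, ?w, ?x, ?y, ?z]" "S = {?u, ?v, ?w, ?x, ?y, ?z}"
      using f(1) unfolding two_K3 bij_betw_def by (auto simp: inj_on_def)
    moreover have "triangle ?u ?v ?w" "triangle ?x ?y ?z"
      using f(2) unfolding two_K3 complete_graph_3 triangle_def by auto
    ultimately show ?R unfolding disjoint_triangles_def by blast
  next
    assume ?R
    then obtain u v w x y z where d: "distinct [u, v, w, x, y, z]" "S = {u, v, w, x, y, z}"
      and t: "triangle u v w" "triangle x y z"
      unfolding disjoint_triangles_def by blast
    let ?f = "case_sum (\<lambda>i. [u, v, w] ! i) (\<lambda>i. [x, y, z] ! i)"
    have "bij_betw ?f (pverts two_K3) S"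
      using d unfolding two_K3 bij_betw_def by (auto simp: inj_on_def)
    moreover have "\<forall>(i, j)\<in>parcs two_K3. (?f i, ?f j) \<in> E"
      using t unfolding two_K3 complete_graph_3 triangle_def by (auto simp: symE)
    ultimately show ?L unfolding contains_spanning_iff[OF wf] by blast
  qed
qed

lemma is_subgraph_of_K23I:
  assumes d: "distinct [p, q, r, s, t]" "S = {p, q, r, s, t}"
    and i: "stable E {p, q}" "stable E {r, s, t}"
  shows "is_subgraph_of (with_proj (induced E S)) (with_proj (complete_bipartite_graph 2 3))"
proof (rule is_subgraph_ofI)
  let ?f = "\<lambda>x. if x = p then Inl 0 else if x = q then Inl 1 else if x = r then Inr 0
    else if x = s then Inr 1 else Inr (2 :: nat) :: nat + nat"
  show "inj_on ?f S" using d by (auto simp: inj_on_def)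
  show "?f ` S \<subseteq> pverts (complete_bipartite_graph 2 3)"
    using d unfolding complete_bipartite_graph_arcs by auto
  show "parcs (complete_bipartite_graph 2 3) \<subseteq>
      pverts (complete_bipartite_graph 2 3) \<times> pverts (complete_bipartite_graph 2 3)"
    unfolding complete_bipartite_graph_arcs by auto
  fix u v assume "(u, v) \<in> E" "u \<in> S" "v \<in> S"
  moreover from this have "u \<in> {p, q} \<and> v \<in> {r, s, t} \<or> v \<in> {p, q} \<and> u \<in> {r, s, t}"
    using d(2) i unfolding stable_def by blast
  ultimately show "(?f u, ?f v) \<in> parcs (complete_bipartite_graph 2 3)"
    using d(1) unfolding complete_bipartite_graph_arcs by auto
qed

lemma is_subgraph_of_K6_minus_3eI:
  assumes d: "distinct [a, a', b, b', c, c']" "S = {a, a', b, b', c, c'}"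
    and ne: "(a, a') \<notin> E" "(b, b') \<notin> E" "(c, c') \<notin> E"
  shows "is_subgraph_of (with_proj (induced E S)) (with_proj K6_minus_3e)"
proof (rule is_subgraph_ofI)
  let ?f = "\<lambda>x. if x = a then 0 else if x = a' then 1 else if x = b then 2
    else if x = b' then 3 else if x = c then 4 else 5 :: nat"
  show "inj_on ?f S" using d by (auto simp: inj_on_def)
  show "?f ` S \<subseteq> pverts K6_minus_3e" unfolding K6_minus_3e by auto
  show "parcs K6_minus_3e \<subseteq> pverts K6_minus_3e \<times> pverts K6_minus_3e" unfolding K6_minus_3e by auto
  fix u v assume "(u, v) \<in> E" "u \<in> S" "v \<in> S"
  then show "(?f u, ?f v) \<in> parcs K6_minus_3e"
    using d ne unfolding K6_minus_3e by (auto simp: symE)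
qed

lemma colorable_if_subgraph_of_bipartite:
  assumes "is_subgraph_of (with_proj (induced E S)) (with_proj (complete_bipartite_graph m n))"
  shows "colorable E S 2"
proof (rule ccontr)
  obtain f where f: "\<And>u v. (u, v) \<in> E \<Longrightarrow> u \<in> S \<Longrightarrow> v \<in> S \<Longrightarrow> (f u, f v) \<in> parcs (complete_bipartite_graph m n)"
    using is_subgraph_ofD[OF assms] by metis
  assume "\<not> ?thesis"
  then show False
    by (rule not_two_colorable[of S "{x \<in> S. isl (f x)}" "{x \<in> S. \<not> isl (f x)}"])
      (use f in \<open>fastforce simp: stable_def complete_bipartite_graph_arcs\<close>)+
qed

lemma colorable_if_subgraph_of_K6_minus_3e:
  assumes "is_subgraph_of (with_proj (induced E S)) (with_proj K6_minus_3e)"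
  shows "colorable E S 3"
proof -
  obtain f where f: "f ` S \<subseteq> {..<6}" "\<And>u v. (u, v) \<in> E \<Longrightarrow> u \<in> S \<Longrightarrow> v \<in> S \<Longrightarrow> (f u, f v) \<in> parcs K6_minus_3e"
    using is_subgraph_ofD[OF assms] unfolding K6_minus_3e(1) by metis
  have "f u div 2 < 3" if "u \<in> S" for u using f(1) that by (auto simp: less_mult_imp_div_less)
  then have cover: "S \<subseteq> {x \<in> S. f x div 2 = 0} \<union> {x \<in> S. f x div 2 = 1} \<union> {x \<in> S. f x div 2 = 2}"
    by fastforce
  have ind: "stable E {x \<in> S. f x div 2 = k}" for k
    using f(2) unfolding stable_def K6_minus_3e by fastforce
  show ?thesis by (rule three_colorableI[OF cover ind ind ind])
qed

text \<open>Being a subgraph of \<open>complete_bipartite_graph 2 3\<close> or of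
  \<open>K6_minus_3e\<close> records that \<open>card S - 3\<close> colours suffice; the
  accompanying conditions guarantee that no deletion saves a colour.\<close>

lemma critical_chi_characterization:
  assumes S: "finite S"
  shows "critical (chi E) 2 S \<longleftrightarrow>
      digraph_iso (with_proj (induced E S)) (with_proj (edgeless_graph 4))
    \<or> (card S = 5
        \<and> contains_spanning (with_proj (induced E S)) (with_proj two_K2_K1)
        \<and> is_subgraph_of (with_proj (induced E S)) (with_proj (complete_bipartite_graph 2 3)))
    \<or> (card S = 6
        \<and> is_subgraph_of (with_proj (induced E S)) (with_proj K6_minus_3e)
        \<and> (digraph_iso (with_proj (induced E S)) (with_proj three_sun)
          \<or> contains_spanning (with_proj (induced E S)) (with_proj two_K3)
          \<or> digraph_iso (with_proj (induced E S)) (with_proj (C5_plus 3))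
          \<or> digraph_iso (with_proj (induced E S)) (with_proj (C5_plus 4))))"
    (is "?L \<longleftrightarrow> ?R4 \<or> ?R5 \<or> ?R6")
proof
  assume L: ?L
  from critical_chi_cases[OF S L] show "?R4 \<or> ?R5 \<or> ?R6"
  proof (elim disjE[of "card S = 4 \<and> stable E S"] disjE[of "card S = 5"])
    assume "card S = 4 \<and> stable E S"
    then show ?thesis using S unfolding iso_edgeless_iff by blast
  next
    assume 5: "card S = 5"
    obtain p q r s t where d: "distinct [p, q, r, s, t]" "S = {p, q, r, s, t}"
      and i: "stable E {p, q}" "stable E {r, s, t}" and e: "(p, r) \<in> E" "(q, s) \<in> E"
      using critical_chi_5[OF 5 L] by metis
    have "distinct [p, r, q, s, t]" "S = {p, r, q, s, t}" using d by auto
    then have ?R5 using 5 e is_subgraph_of_K23I[OF d i] unfolding contains_spanning_two_K2_K1_iff by blast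
    then show ?thesis by blast
  next
    assume 6: "card S = 6 \<and>
      (disjoint_triangles S \<or> digraph_iso (with_proj (induced E S)) (with_proj three_sun) \<or>
       digraph_iso (with_proj (induced E S)) (with_proj (C5_plus 3)) \<or>
       digraph_iso (with_proj (induced E S)) (with_proj (C5_plus 4)))"
    then obtain a a' b b' c c' where "distinct [a, a', b, b', c, c']" "S = {a, a', b, b', c, c'}"
      "(a, a') \<notin> E" "(b, b') \<notin> E" "(c, c') \<notin> E"
      using critical_chi_6 L by metis
    from is_subgraph_of_K6_minus_3eI[OF this] have ?R6
      using 6 unfolding contains_spanning_two_K3_iff by blast
    then show ?thesis by blast
  qed
next
  assume "?R4 \<or> ?R5 \<or> ?R6"
  then show ?L
  proof (elim disjE[of ?R4] disjE[of ?R5])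
    assume ?R4
    then show ?thesis using critical_chi_4I unfolding iso_edgeless_iff by blast
  next
    assume 5: ?R5
    then obtain p q r s t where "distinct [p, q, r, s, t]" "S = {p, q, r, s, t}" "(p, q) \<in> E" "(r, s) \<in> E"
      unfolding contains_spanning_two_K2_K1_iff by blast
    then show ?thesis
      using critical_chi_5I[of S p q r s] 5 colorable_if_subgraph_of_bipartite by auto
  next
    assume ?R6
    then show ?thesis
      unfolding contains_spanning_two_K3_iff
      using critical_chi_6I colorable_if_subgraph_of_K6_minus_3e by blast
  qed
qed

end

text \<open>The exceptions are named as whole graphs, whereas criticality concerns the graph after
  deletion of \<open>v\<close>; this translates between the two, with \<open>None\<close> in the
  role of \<open>v\<close>.\<close>

lemma digraph_iso_add_dominating_iff:
  assumes G: "pair_graph G" and K: "pair_graph K"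
  shows "digraph_iso (with_proj G) (with_proj (add_dominating K)) \<longleftrightarrow>
    (\<exists>v. dominating_vertex G v \<and>
      digraph_iso (with_proj (induced (parcs G) (pverts G - {v}))) (with_proj K))"
    (is "?L \<longleftrightarrow> ?R")
proof -
  have K': "parcs K \<subseteq> pverts K \<times> pverts K" using K pair_graph_iff by blast
  have V: "pverts (add_dominating K) = insert None (Some ` pverts K)"
    and A: "parcs (add_dominating K) = map_prod Some Some ` parcs K \<union>
       {None} \<times> Some ` pverts K \<union> Some ` pverts K \<times> {None}"
    unfolding add_dominating_def by auto
  have wf: "parcs (add_dominating K) \<subseteq> pverts (add_dominating K) \<times> pverts (add_dominating K)"
    unfolding V A using K' by auto
  have sym: "(u, v) \<in> parcs G \<longleftrightarrow> (v, u) \<in> parcs G" and irr: "(u, u) \<notin> parcs G" for u v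
    using G unfolding pair_graph_iff by (auto dest: symD simp: irrefl_def)
  note iff = digraph_iso_induced_iff[OF wf, of "parcs G" "pverts G", unfolded induced_parcs[OF G]]
  note iffK = digraph_iso_induced_iff[OF K', of "parcs G"]
  show ?thesis
  proof
    assume ?L
    then obtain f where f: "bij_betw f (pverts (add_dominating K)) (pverts G)"
      and arcs: "\<And>i j. i \<in> pverts (add_dominating K) \<Longrightarrow> j \<in> pverts (add_dominating K) \<Longrightarrow>
        (f i, f j) \<in> parcs G \<longleftrightarrow> (i, j) \<in> parcs (add_dominating K)"
      unfolding iff by blast
    let ?v = "f None"
    have inj: "inj_on f (insert None (Some ` pverts K))" and im: "pverts G = insert ?v (f ` Some ` pverts K)"
      using f unfolding bij_betw_def V by auto
    have notin: "?v \<notin> f ` Some ` pverts K" using inj by (auto simp: inj_on_def)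
    have "dominating_vertex G ?v"
      unfolding dominating_vertex_def im using arcs[of None] unfolding V A by auto
    moreover have "bij_betw (f \<circ> Some) (pverts K) (pverts G - {?v})"
      using inj notin unfolding bij_betw_def im by (auto simp: inj_on_def image_comp)
    moreover have "((f \<circ> Some) i, (f \<circ> Some) j) \<in> parcs G \<longleftrightarrow> (i, j) \<in> parcs K"
      if "i \<in> pverts K" "j \<in> pverts K" for i j
      using arcs[of "Some i" "Some j"] that unfolding V A by auto
    ultimately show ?R unfolding iffK by blast
  next
    assume ?R
    then obtain v g where v: "dominating_vertex G v" and g: "bij_betw g (pverts K) (pverts G - {v})"
      and arcs: "\<And>i j. i \<in> pverts K \<Longrightarrow> j \<in> pverts K \<Longrightarrow> (g i, g j) \<in> parcs G \<longleftrightarrow> (i, j) \<in> parcs K"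
      unfolding iffK by blast
    let ?f = "case_option v g"
    have gi: "inj_on g (pverts K)" "g ` pverts K = pverts G - {v}" using g unfolding bij_betw_def by auto
    then have gv: "g i \<in> pverts G - {v}" if "i \<in> pverts K" for i using that by blast
    have "inj_on ?f (pverts (add_dominating K))"
      using gi(1) gv unfolding V by (auto simp: inj_on_def)
    moreover have "?f ` pverts (add_dominating K) = insert v (g ` pverts K)"
      unfolding V by (auto simp: image_image)
    moreover have "insert v (g ` pverts K) = pverts G"
      using gi(2) v unfolding dominating_vertex_def by auto
    moreover have "(?f i, ?f j) \<in> parcs G \<longleftrightarrow> (i, j) \<in> parcs (add_dominating K)"
      if ij: "i \<in> pverts (add_dominating K)" "j \<in> pverts (add_dominating K)" for i j
    proof -
      have "(v, g i) \<in> parcs G" "(g i, v) \<in> parcs G" if "i \<in> pverts K" for i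
        using gv[OF that] v sym[of v "g i"] unfolding dominating_vertex_def by auto
      then show ?thesis using ij arcs irr unfolding V A by auto
    qed
    ultimately show ?L unfolding iff bij_betw_def by metis
  qed
qed

section \<open>Comparison of the two families of forbidden graphs\<close>

context sym_irrefl
begin

lemma iso_C5D:
  assumes "digraph_iso (with_proj (induced E S)) (with_proj C5)"
  obtains a b c d e where "pentagon E a b c d e" "S = {a, b, c, d, e}"
  using assms unfolding iso_C5_iff by (elim exE conjE) (rule that)

text \<open>The pair \<open>w\<close>, \<open>d\<close>, in which the two graphs differ, is left
  open, so that both can be treated alike.\<close>

lemma iso_C5_plusD:
  assumes "digraph_iso (with_proj (induced E S)) (with_proj (C5_plus 3)) \<or>
    digraph_iso (with_proj (induced E S)) (with_proj (C5_plus 4))"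
  obtains a b c d e w where "pentagon E a b c d e" "w \<notin> {a, b, c, d, e}" "S = {a, b, c, d, e, w}"
    "(w, a) \<in> E" "(w, b) \<in> E" "(w, c) \<in> E" "(w, e) \<notin> E"
  using assms unfolding iso_C5_plus_3_iff iso_C5_plus_4_iff by (elim disjE exE conjE) (rule that; assumption)+

lemma iso_C5_not_critical_chi:
  assumes "digraph_iso (with_proj (induced E S)) (with_proj C5)"
  shows "\<not> critical (chi E) 2 S"
  using assms by (rule iso_C5D) (rule pentagon_not_critical_chi)

lemma iso_C5_plus_not_critical_omega:
  assumes "digraph_iso (with_proj (induced E S)) (with_proj (C5_plus 3)) \<or>
    digraph_iso (with_proj (induced E S)) (with_proj (C5_plus 4))"
  shows "\<not> critical (omega E) 2 S"
  using assms by (rule iso_C5_plusD) (rule pentagon_plus_not_critical_omega)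

text \<open>The second alternative is meant for the extra vertex of \<open>C5_plus 3\<close> and
  \<open>C5_plus 4\<close>, which misses \<open>e\<close>.\<close>

lemma not_dominating_in_pentagon:
  assumes p: "pentagon E a b c d e" and v: "v \<in> {a, b, c, d, e} \<or> (v, e) \<notin> E \<and> v \<noteq> e"
  shows "\<exists>u\<in>{a, b, c, d, e} - {v}. (v, u) \<notin> E"
  using assms unfolding pentagon_def by (auto simp: symE)

end

text \<open>Criticality and an isomorphism to an exceptional graph each supply a dominating vertex,
  and the two must be identified. A second dominating vertex would dominate \<open>G - u\<close>,
  but none of the three graphs has one.\<close>

lemma two_dominating_vertices:
  assumes G: "pair_graph G" and u: "dominating_vertex G u" and v: "dominating_vertex G v"
    and K: "K \<in> {C5, C5_plus 3, C5_plus 4}"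
      "digraph_iso (with_proj (induced (parcs G) (pverts G - {u}))) (with_proj K)"
  shows "u = v"
proof (rule ccontr)
  assume ne: "u \<noteq> v"
  interpret sym_irrefl "parcs G"
    using G by unfold_locales (auto simp: pair_graph_iff)
  let ?S = "pverts G - {u}"
  have dom: "(v, w) \<in> parcs G" if "w \<in> ?S - {v}" for w
    using v that unfolding dominating_vertex_def by blast
  have vS: "v \<in> ?S" using v ne unfolding dominating_vertex_def by blast
  obtain a b c d e where p: "pentagon (parcs G) a b c d e" "{a, b, c, d, e} \<subseteq> ?S"
    and v': "v \<in> {a, b, c, d, e} \<or> (v, e) \<notin> parcs G \<and> v \<noteq> e"
  proof -
    have "\<exists>a b c d e. pentagon (parcs G) a b c d e \<and> {a, b, c, d, e} \<subseteq> ?S \<and>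
      (v \<in> {a, b, c, d, e} \<or> (v, e) \<notin> parcs G \<and> v \<noteq> e)"
    proof (cases "K = C5")
      case True
      obtain a b c d e where p: "pentagon (parcs G) a b c d e" "?S = {a, b, c, d, e}"
        using K(2) unfolding True by (rule iso_C5D)
      then have "{a, b, c, d, e} \<subseteq> ?S" "v \<in> {a, b, c, d, e}" using vS by auto
      with p(1) show ?thesis by blast
    next
      case False
      then have "digraph_iso (with_proj (induced (parcs G) ?S)) (with_proj (C5_plus 3)) \<or>
          digraph_iso (with_proj (induced (parcs G) ?S)) (with_proj (C5_plus 4))"
        using K by auto
      then obtain a b c d e w where p: "pentagon (parcs G) a b c d e" "w \<notin> {a, b, c, d, e}"
        "?S = {a, b, c, d, e, w}" "(w, e) \<notin> parcs G" by (rule iso_C5_plusD)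
      then have "{a, b, c, d, e} \<subseteq> ?S" "v \<in> {a, b, c, d, e} \<or> (v, e) \<notin> parcs G \<and> v \<noteq> e"
        using vS by auto
      with p(1) show ?thesis by blast
    qed
    then show thesis using that by blast
  qed
  from not_dominating_in_pentagon[OF p(1) v'] p(2) dom show False by blast
qed

lemma F_omega_minus_W5:
  fixes G :: "'a pair_pre_digraph"
  assumes "G \<in> F_omega 2" "\<not> digraph_iso (with_proj G) (with_proj W5)"
  shows "G \<in> F_chi 2" "\<not> digraph_iso (with_proj G) (with_proj (add_dominating (C5_plus 3)))"
    "\<not> digraph_iso (with_proj G) (with_proj (add_dominating (C5_plus 4)))"
proof -
  have G: "pair_graph G" using assms(1) unfolding F_omega_def min_forbidden_def by blast
  interpret sym_irrefl "parcs G" using G by unfold_locales (auto simp: pair_graph_iff)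
  obtain v where v: "dominating_vertex G v" and crit: "critical (omega (parcs G)) 2 (pverts G - {v})"
    using assms(1) unfolding F_omega_iff[OF G] by blast
  let ?S = "pverts G - {v}"
  have fin: "finite ?S" using G pair_graph_iff by blast
  have "\<not> digraph_iso (with_proj (induced (parcs G) ?S)) (with_proj C5)"
    using assms(2) v unfolding W5_def digraph_iso_add_dominating_iff[OF G pair_graph_C5] by blast
  from critical_chi_of_critical_omega[OF fin crit this] show "G \<in> F_chi 2"
    using v unfolding F_chi_iff[OF G] by blast
  have no: "\<not> digraph_iso (with_proj (induced (parcs G) ?S)) (with_proj (C5_plus 3))"
    "\<not> digraph_iso (with_proj (induced (parcs G) ?S)) (with_proj (C5_plus 4))"
    using iso_C5_plus_not_critical_omega crit by blast+
  have K: "pair_graph (C5_plus 3)" "pair_graph (C5_plus 4)" using pair_graph_C5_plus by auto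
  \<comment> \<open>An isomorphism would bring its own dominating vertex; it has to be
    \<open>v\<close>, where \<open>no\<close> excludes the graph.\<close>
  show "\<not> digraph_iso (with_proj G) (with_proj (add_dominating (C5_plus 3)))"
    using no(1) two_dominating_vertices[OF G _ v, of _ "C5_plus 3"]
    unfolding digraph_iso_add_dominating_iff[OF G K(1)] by blast
  show "\<not> digraph_iso (with_proj G) (with_proj (add_dominating (C5_plus 4)))"
    using no(2) two_dominating_vertices[OF G _ v, of _ "C5_plus 4"]
    unfolding digraph_iso_add_dominating_iff[OF G K(2)] by blast
qed

lemma F_chi_minus_C5_plus:
  fixes G :: "'a pair_pre_digraph"
  assumes "G \<in> F_chi 2"
    and "\<not> digraph_iso (with_proj G) (with_proj (add_dominating (C5_plus 3)))"
    and "\<not> digraph_iso (with_proj G) (with_proj (add_dominating (C5_plus 4)))"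
  shows "G \<in> F_omega 2" "\<not> digraph_iso (with_proj G) (with_proj W5)"
proof -
  have G: "pair_graph G" using assms(1) unfolding F_chi_def min_forbidden_def by blast
  interpret sym_irrefl "parcs G" using G by unfold_locales (auto simp: pair_graph_iff)
  obtain v where v: "dominating_vertex G v" and crit: "critical (chi (parcs G)) 2 (pverts G - {v})"
    using assms(1) unfolding F_chi_iff[OF G] by blast
  let ?S = "pverts G - {v}"
  have fin: "finite ?S" using G pair_graph_iff by blast
  have K: "pair_graph (C5_plus 3)" "pair_graph (C5_plus 4)" using pair_graph_C5_plus by auto
  have no: "\<not> digraph_iso (with_proj (induced (parcs G) ?S)) (with_proj (C5_plus 3))"
    "\<not> digraph_iso (with_proj (induced (parcs G) ?S)) (with_proj (C5_plus 4))"
    using assms(2,3) v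
    unfolding digraph_iso_add_dominating_iff[OF G K(1)] digraph_iso_add_dominating_iff[OF G K(2)] by blast+
  from critical_omega_of_critical_chi[OF fin crit this] show "G \<in> F_omega 2"
    using v unfolding F_omega_iff[OF G] by blast
  have "\<not> digraph_iso (with_proj (induced (parcs G) ?S)) (with_proj C5)"
    using iso_C5_not_critical_chi crit by blast
  then show "\<not> digraph_iso (with_proj G) (with_proj W5)"
    using two_dominating_vertices[OF G _ v, of _ C5]
    unfolding W5_def digraph_iso_add_dominating_iff[OF G pair_graph_C5] by blast
qed

theorem theorem7:
  fixes G :: "'a pair_pre_digraph"
  assumes "pair_graph G"
  shows "(G \<in> F_chi 2 \<longleftrightarrow>
      (\<exists>v. dominating_vertex G v \<and>
        (let G' = pre_digraph.del_vert (with_proj G) v in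
          digraph_iso G' (with_proj (edgeless_graph 4))
        \<or> (card (verts G') = 5
            \<and> contains_spanning G' (with_proj (disjoint_union
                (disjoint_union (complete_graph 2) (complete_graph 2)) (complete_graph 1)))
            \<and> is_subgraph_of G' (with_proj (complete_bipartite_graph 2 3)))
        \<or> (card (verts G') = 6
            \<and> is_subgraph_of G' (with_proj K6_minus_3e)
            \<and> (digraph_iso G' (with_proj three_sun)
              \<or> contains_spanning G'
                  (with_proj (disjoint_union (complete_graph 3) (complete_graph 3)))
              \<or> digraph_iso G' (with_proj (C5_plus 3))
              \<or> digraph_iso G' (with_proj (C5_plus 4)))))))
    \<and> (F_omega 2 :: 'a pair_pre_digraph set)
          - {H. digraph_iso (with_proj H) (with_proj W5)}
        = F_chi 2
          - {H. digraph_iso (with_proj H) (with_proj (add_dominating (C5_plus 3)))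
              \<or> digraph_iso (with_proj H) (with_proj (add_dominating (C5_plus 4)))}"
proof (rule conjI, goal_cases)
  case 1
  interpret sym_irrefl "parcs G" using assms by unfold_locales (auto simp: pair_graph_iff)
  have "finite (pverts G - {v})" for v using assms pair_graph_iff by blast
  note char = critical_chi_characterization[OF this]
  show ?case
    unfolding F_chi_iff[OF assms] Let_def del_vert_with_proj[OF assms] char with_proj_simps(1) induced_simps(1) ..
next
  case 2
  show ?case
    using F_omega_minus_W5 F_chi_minus_C5_plus by (intro set_eqI) (unfold Diff_iff mem_Collect_eq, blast)
qed

end
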